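(* Consider the dynamic inventory management problem described in the context, with independent demands $D_1,D_2,\ldots$ having common density $\psi$. If the demand density $\psi$ is in the typical class and if $\psi$ has bounded support, then the inventory cost $\mathcal{C}_n(\pi_n^* )$ realized under the mean-optimal policy $\pi_n^*$ obeys the asymptotic normal law $$\frac{\mathcal{C}_n(\pi_n^* )-\mathbb{E}[\mathcal{C}_n(\pi_n^* )]}{\sqrt{\operatorname{Var}[\mathcal{C}_n(\pi_n^* )]}}\Longrightarrow N(0,1)\qquad\text{as } n\to\infty.$$
   Context: Inventory problem. There are $n$ periods and independent demands $D_1,\ldots,D_n$ with common density $\psi$ and cumulative distribution function $\Psi$; $\psi$ is supported on a bounded interval contained in $[0,\infty)$, say in $[0,J]$ with $0<J<\infty$. The cost parameters are the purchase cost rate $c\ge 0$, the holding cost rate $c_h>0$ and the backlog penalty rate $c_p$, with $c<c_p$. Put $L(x)=c_hx$ for $x\ge 0$ and $L(x)=-c_px$ for $x<0$. If the generalized inventory (possibly negative, meaning backlog) at the start of a period is $x$, one chooses a level $y\ge x$ (instantaneous fulfillment, purchase cost $c(y-x)$), the demand $D$ is then realized, the cost $L(y-D)$ is incurred, and the next period starts with inventory $y-D$. Demand unmet at the end of period $n$ is lost. The minimal expected cost $v_k(x)$ with $k$ periods remaining satisfies $v_0\equiv 0$ and, for $1\le k\le n$, $$v_k(x)=\min_{y\ge x}\big\{c(y-x)+\mathbb{E}[L(y-D_{n-k+1})]+\mathbb{E}[v_{k-1}(y-D_{n-k+1})]\big\}.$$ Optimal policy. The policy $\pi_n^*$ minimizing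 total expected cost is a base-stock policy: let $s_k$ be the (smallest) minimizer over $y\in\mathbb{R}$ of $cy+\mathbb{E}[L(y-D_1)]+\mathbb{E}[v_{k-1}(y-D_1)]$. It is known that $s_1\le s_2\le\cdots$, that $s_1=\Psi^{-1}\big(\frac{c_p-c}{c_h+c_p}\big)$ and that $s_k\le s_\infty:=\Psi^{-1}\big(\frac{c_p}{c_h+c_p}\big)$ for all $k$, where $\Psi^{-1}(u)=\inf\{w:\Psi(w)\ge u\}$. At time $i$ with inventory $x$, the optimal restocked level is $\gamma_{n,i}(x)=\max\{x,s_{n-i+1}\}$. Realized cost. The initial inventory is $X_{n,1}=x$, where $x\in[-s_\infty,s_\infty]$ is fixed, and $X_{n,i+1}=\gamma_{n,i}(X_{n,i})-D_i$ for $1\le i\le n$. The realized total cost under $\pi_n^*$ is $$\mathcal{C}_n(\pi_n^* )=\sum_{i=1}^n\big\{c(\gamma_{n,i}(X_{n,i})-X_{n,i})+L(X_{n,i+1})\big\}.$$ Typical class. A probability density $\psi$ (defined on $\mathbb{R}$, zero off its support) is in the typical class if for each $\epsilon\ge 0$ there is $\widehat{w}=\widehat{w}(\epsilon)$ such that $\psi(w)-\psi(w+\epsilon)\le 0$ for all $w\le\widehat{w}$ and $\psi(w)-\psi(w+\epsilon)\ge 0$ for all $w\ge\widehat{w}$. *)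

theory Defs
  imports "HOL-Probability.Probability"
begin

definition typical_class :: "(real \<Rightarrow> real) \<Rightarrow> bool" where
  "typical_class \<psi> \<longleftrightarrow>
     (\<forall>\<epsilon>\<ge>0. \<exists>w_hat. (\<forall>w\<le>w_hat. \<psi> w - \<psi> (w + \<epsilon>) \<le> 0) \<and> (\<forall>w\<ge>w_hat. \<psi> w - \<psi> (w + \<epsilon>) \<ge> 0))"

text \<open>Law of a single demand. Integrals against it are the expectations \<open>E[f(D\<^sub>i)]\<close>, which do
  not depend on \<open>i\<close>.\<close>

definition demand_law :: "(real \<Rightarrow> real) \<Rightarrow> real measure" where
  "demand_law \<psi> = density lborel (\<lambda>w. ennreal (\<psi> w))"

definition quantile :: "(real \<Rightarrow> real) \<Rightarrow> real \<Rightarrow> real" where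
  "quantile \<psi> u = Inf {w. cdf (demand_law \<psi>) w \<ge> u}"

definition stage_loss :: "real \<Rightarrow> real \<Rightarrow> real \<Rightarrow> real" where
  "stage_loss c\<^sub>h c\<^sub>p x = (if x \<ge> 0 then c\<^sub>h * x else - c\<^sub>p * x)"

text \<open>The minimal expected cost with \<open>k\<close> periods remaining. For \<open>c\<^sub>h > 0\<close>, \<open>c\<^sub>p > c \<ge> 0\<close> and a
  boundedly supported density the expression inside is continuous in \<open>y\<close> and tends to infinity
  as \<open>y\<close> does, so the infimum over \<open>y \<ge> x\<close> is a minimum.\<close>

primrec cost_to_go :: "(real \<Rightarrow> real) \<Rightarrow> real \<Rightarrow> real \<Rightarrow> real \<Rightarrow> nat \<Rightarrow> real \<Rightarrow> real" where
  "cost_to_go \<psi> c c\<^sub>h c\<^sub>p 0 = (\<lambda>x. 0)"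
| "cost_to_go \<psi> c c\<^sub>h c\<^sub>p (Suc k) = (\<lambda>x. INF y\<in>{x..}.
     c * (y - x) + (\<integral>w. stage_loss c\<^sub>h c\<^sub>p (y - w) \<partial>demand_law \<psi>)
       + (\<integral>w. cost_to_go \<psi> c c\<^sub>h c\<^sub>p k (y - w) \<partial>demand_law \<psi>))"

text \<open>The smallest minimizer \<open>s\<^sub>k\<close>; only meaningful for \<open>k \<ge> 1\<close>.\<close>

definition base_stock :: "(real \<Rightarrow> real) \<Rightarrow> real \<Rightarrow> real \<Rightarrow> real \<Rightarrow> nat \<Rightarrow> real" where
  "base_stock \<psi> c c\<^sub>h c\<^sub>p k =
     (LEAST y. is_arg_min
        (\<lambda>y. c * y + (\<integral>w. stage_loss c\<^sub>h c\<^sub>p (y - w) \<partial>demand_law \<psi>)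
               + (\<integral>w. cost_to_go \<psi> c c\<^sub>h c\<^sub>p (k - 1) (y - w) \<partial>demand_law \<psi>))
        (\<lambda>y. True) y)"

definition base_stock_limit :: "(real \<Rightarrow> real) \<Rightarrow> real \<Rightarrow> real \<Rightarrow> real" where
  "base_stock_limit \<psi> c\<^sub>h c\<^sub>p = quantile \<psi> (c\<^sub>p / (c\<^sub>h + c\<^sub>p))"

definition restock_level ::
  "(real \<Rightarrow> real) \<Rightarrow> real \<Rightarrow> real \<Rightarrow> real \<Rightarrow> nat \<Rightarrow> nat \<Rightarrow> real \<Rightarrow> real" where
  "restock_level \<psi> c c\<^sub>h c\<^sub>p n i x = max x (base_stock \<psi> c c\<^sub>h c\<^sub>p (n - i + 1))"

text \<open>The inventory \<open>X\<^sub>n\<^sub>,\<^sub>i\<close> at the start of period \<open>i\<close>, along the demand path \<open>d 1, d 2, \<dots>\<close>.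
  Periods are numbered from 1; the value at \<open>i = 0\<close> is a dummy that is never used.\<close>

primrec inventory ::
  "(real \<Rightarrow> real) \<Rightarrow> real \<Rightarrow> real \<Rightarrow> real \<Rightarrow> nat \<Rightarrow> real \<Rightarrow> (nat \<Rightarrow> real) \<Rightarrow> nat \<Rightarrow> real" where
  "inventory \<psi> c c\<^sub>h c\<^sub>p n x d 0 = x"
| "inventory \<psi> c c\<^sub>h c\<^sub>p n x d (Suc i) =
     (if i = 0 then x
      else restock_level \<psi> c c\<^sub>h c\<^sub>p n i (inventory \<psi> c c\<^sub>h c\<^sub>p n x d i) - d i)"

definition realized_cost ::
  "(real \<Rightarrow> real) \<Rightarrow> real \<Rightarrow> real \<Rightarrow> real \<Rightarrow> nat \<Rightarrow> real \<Rightarrow> (nat \<Rightarrow> real) \<Rightarrow> real" where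
  "realized_cost \<psi> c c\<^sub>h c\<^sub>p n x d =
     (\<Sum>i=1..n. c * (restock_level \<psi> c c\<^sub>h c\<^sub>p n i (inventory \<psi> c c\<^sub>h c\<^sub>p n x d i)
                       - inventory \<psi> c c\<^sub>h c\<^sub>p n x d i)
               + stage_loss c\<^sub>h c\<^sub>p (inventory \<psi> c c\<^sub>h c\<^sub>p n x d (i + 1)))"

end

theory Submission
  imports Defs
begin

text \<open>
  The purchase costs telescope, so up to a bounded term the cost is the sum of
  \<open>c * D\<^sub>i + L (Y\<^sub>i - D\<^sub>i)\<close>, where \<open>Y\<^sub>i\<close> is the restocked level. If \<open>Y\<^sub>i\<close> were the constant
  \<open>s\<^sup>* = lim s\<^sub>k\<close>, this would be a sum of independent identically distributed variables, to which the
  classical central limit theorem applies; the proof shows that the difference has variance \<open>o(n)\<close>.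

  Since \<open>s\<^sub>k\<close> increases and is bounded by \<open>s\<^sub>\<infinity>\<close>, the target levels move down by a bounded total amount
  over the whole horizon. Each demand shrinks the excess of \<open>Y\<^sub>i\<close> over the current target by an
  independent random factor with second moment below 1, so the sum of all excesses is bounded in
  \<open>L\<^sup>2\<close>, uniformly in \<open>n\<close>. Replacing the targets by \<open>s\<^sup>*\<close> then changes a sum of independent terms, at
  a cost in variance of order \<open>\<Sum>\<^sub>k (s\<^sup>* - s\<^sub>k)\<^sup>2 = o(n)\<close>.
\<close>

section \<open>Second moments and perturbation of weak limits\<close>

lemma sum_weighted_square_le:
  fixes w x :: "'i \<Rightarrow> real"
  assumes "\<And>i. i \<in> I \<Longrightarrow> 0 \<le> w i"
  shows "(\<Sum>i\<in>I. w i * x i)\<^sup>2 \<le> (\<Sum>i\<in>I. w i) * (\<Sum>i\<in>I. w i * (x i)\<^sup>2)"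
proof -
  have "(\<Sum>i\<in>I. w i * x i) = (\<Sum>i\<in>I. sqrt (w i) * (sqrt (w i) * x i))"
    using assms by (intro sum.cong refl) (simp add: mult.assoc[symmetric] del: mult.assoc)
  also have "\<dots>\<^sup>2 \<le> (\<Sum>i\<in>I. (sqrt (w i))\<^sup>2) * (\<Sum>i\<in>I. (sqrt (w i) * x i)\<^sup>2)"
    by (rule Cauchy_Schwarz_ineq_sum)
  also have "\<dots> = (\<Sum>i\<in>I. w i) * (\<Sum>i\<in>I. w i * (x i)\<^sup>2)"
    using assms by (intro arg_cong2[where f="(*)"] sum.cong refl) (simp_all add: power_mult_distrib)
  finally show ?thesis .
qed

text \<open>Applied to the squared distances of the base-stock levels from their limit; it is what
  makes the variance of the replaced terms \<open>o(n)\<close>.\<close>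

lemma cesaro_null:
  fixes a :: "nat \<Rightarrow> real"
  assumes "a \<longlonglongrightarrow> 0"
  shows "(\<lambda>n. (\<Sum>i<n. a i) / n) \<longlonglongrightarrow> 0"
proof (rule LIMSEQ_I)
  fix r :: real assume r: "0 < r"
  obtain N where N: "\<And>i. i \<ge> N \<Longrightarrow> \<bar>a i\<bar> < r / 2"
    using LIMSEQ_D[OF assms, of "r / 2"] r by auto
  define B where "B = (\<Sum>i<N. \<bar>a i\<bar>)"
  have "0 \<le> B" by (simp add: B_def sum_nonneg)
  show "\<exists>m. \<forall>n\<ge>m. norm ((\<Sum>i<n. a i) / n - 0) < r"
  proof (intro exI[of _ "max (Suc N) (Suc (nat \<lceil>2 * B / r\<rceil>))"] allI impI)
    \<comment> \<open>The threshold exceeds \<open>2 * B / r\<close>, so the fixed initial block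
      stays below \<open>n * r / 2\<close>; the later terms are each below
      \<open>r / 2\<close>.\<close>
    fix n assume n: "max (Suc N) (Suc (nat \<lceil>2 * B / r\<rceil>)) \<le> n"
    then have "2 * B / r < n" by linarith
    then have B: "B < n * r / 2" using r by (simp add: field_simps)
    have "(\<Sum>i<n. \<bar>a i\<bar>) = B + (\<Sum>i=N..<n. \<bar>a i\<bar>)"
      unfolding B_def using n sum.atLeastLessThan_concat[of 0 N n "\<lambda>i. \<bar>a i\<bar>"]
      by (simp add: lessThan_atLeast0)
    also have "(\<Sum>i=N..<n. \<bar>a i\<bar>) \<le> (\<Sum>i=N..<n. r / 2)"
      using N by (intro sum_mono) (auto intro: less_imp_le)
    also have "\<dots> \<le> n * r / 2" using r n by (auto simp: field_simps)
    finally have "(\<Sum>i<n. \<bar>a i\<bar>) < n * r" using B by simp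
    then have "\<bar>\<Sum>i<n. a i\<bar> < n * r" using sum_abs[of a "{..<n}"] by linarith
    then show "norm ((\<Sum>i<n. a i) / n - 0) < r" using n by (simp add: field_simps)
  qed
qed

text \<open>Unrolling: an amount entering at time \<open>j\<close> survives until time
  \<open>i\<close> with factor \<open>\<Prod>l=j..<i. q l\<close>. Exchanging the order of summation
  collects everything that stems from the same \<open>j\<close>, and the starting value counts as
  entering at time 0.\<close>

lemma sum_contracting_recursion_le:
  fixes e \<delta> q :: "nat \<Rightarrow> real"
  assumes rec: "\<And>i. e (Suc i) \<le> (e i + \<delta> i) * q i"
    and nonneg: "\<And>i. 0 \<le> \<delta> i" "\<And>i. 0 \<le> q i"
  shows "(\<Sum>i<n. e i) \<le>
    (\<Sum>j<n. (\<delta> j + (if j = 0 then e 0 else 0)) * (\<Sum>i=j..<n. \<Prod>l=j..<i. q l))"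
proof -
  define w where "w j = \<delta> j + (if j = 0 then e 0 else 0)" for j
  \<comment> \<open>The induction bounds \<open>e i + \<delta> i\<close> instead of
    \<open>e i\<close>, because this is the quantity that the recursion multiplies by
    \<open>q i\<close>.\<close>
  have step: "e i + \<delta> i \<le> (\<Sum>j\<le>i. w j * (\<Prod>l=j..<i. q l))" for i
  proof (induction i)
    case 0
    show ?case by (simp add: w_def)
  next
    case (Suc i)
    have "e (Suc i) \<le> (\<Sum>j\<le>i. w j * (\<Prod>l=j..<i. q l)) * q i"
      using rec[of i] Suc nonneg by (intro order_trans[OF rec] mult_right_mono) auto
    also have "\<dots> = (\<Sum>j\<le>i. w j * (\<Prod>l=j..<Suc i. q l))"
      by (simp add: sum_distrib_right mult.assoc)
    finally show ?case by (simp add: w_def)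
  qed
  have "(\<Sum>i<n. e i) \<le> (\<Sum>i<n. \<Sum>j\<le>i. w j * (\<Prod>l=j..<i. q l))"
    using step nonneg by (intro sum_mono order_trans[OF _ step]) auto
  also have "\<dots> = (\<Sum>i<n. \<Sum>j | j \<in> {..<n} \<and> j \<le> i. w j * (\<Prod>l=j..<i. q l))"
    by (intro sum.cong) auto
  also have "\<dots> = (\<Sum>j<n. \<Sum>i | i \<in> {..<n} \<and> j \<le> i. w j * (\<Prod>l=j..<i. q l))"
    by (rule sum.swap_restrict) auto
  also have "\<dots> = (\<Sum>j<n. w j * (\<Sum>i=j..<n. \<Prod>l=j..<i. q l))"
    unfolding sum_distrib_left by (intro sum.cong) auto
  finally show ?thesis by (simp add: w_def)
qed

section \<open>Second moments of sums of independent variables\<close>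

context prob_space
begin

text \<open>Each new summand is independent of the partial sum and has mean zero, so the cross term
  vanishes. Integrability is carried along in the conclusion because the induction needs it for the
  partial sum.\<close>

lemma expectation_sum_square_indep:
  fixes X :: "'i \<Rightarrow> 'a \<Rightarrow> real"
  assumes "finite I" and "indep_vars (\<lambda>_. borel) X I"
    and "\<And>i. i \<in> I \<Longrightarrow> expectation (X i) = 0"
    and "\<And>i. i \<in> I \<Longrightarrow> integrable M (\<lambda>\<omega>. (X i \<omega>)\<^sup>2)"
  shows "integrable M (\<lambda>\<omega>. (\<Sum>i\<in>I. X i \<omega>)\<^sup>2) \<and>
    expectation (\<lambda>\<omega>. (\<Sum>i\<in>I. X i \<omega>)\<^sup>2) = (\<Sum>i\<in>I. expectation (\<lambda>\<omega>. (X i \<omega>)\<^sup>2))"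
  using assms
proof (induction I rule: finite_induct)
  case (insert i I)
  have rv: "random_variable borel (X j)" if "j \<in> insert i I" for j
    using insert.prems(1) that unfolding indep_vars_def2 by blast
  have int: "integrable M (X j)" if "j \<in> insert i I" for j
    using insert.prems(3)[OF that] rv[OF that] by (rule square_integrable_imp_integrable[rotated])
  let ?S = "\<lambda>\<omega>. \<Sum>j\<in>I. X j \<omega>"
  have IH: "integrable M (\<lambda>\<omega>. (?S \<omega>)\<^sup>2)"
    "expectation (\<lambda>\<omega>. (?S \<omega>)\<^sup>2) = (\<Sum>i\<in>I. expectation (\<lambda>\<omega>. (X i \<omega>)\<^sup>2))"
    using insert.IH[OF indep_vars_subset[OF insert.prems(1)]] insert.prems by auto
  have intS: "integrable M ?S" using int by (intro Bochner_Integration.integrable_sum) auto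
  have ind: "indep_var borel (X i) borel ?S"
    by (rule indep_vars_sum[OF insert.hyps insert.prems(1)])
  have "integrable M (\<lambda>\<omega>. X i \<omega> * ?S \<omega>)"
    and cross: "expectation (\<lambda>\<omega>. X i \<omega> * ?S \<omega>) = 0"
    using indep_var_integrable[OF ind] indep_var_lebesgue_integral[OF ind] int intS insert.prems(2)
    by auto
  moreover have "(\<Sum>j\<in>insert i I. X j \<omega>)\<^sup>2 = (X i \<omega>)\<^sup>2 + 2 * (X i \<omega> * ?S \<omega>) + (?S \<omega>)\<^sup>2" for \<omega>
    using insert.hyps by (simp add: power2_sum)
  ultimately show ?case
    using IH insert.prems insert.hyps by (simp add: cross)
qed simp

lemma variance_sum_indep:
  fixes X :: "'i \<Rightarrow> 'a \<Rightarrow> real"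
  assumes "finite I" and "indep_vars (\<lambda>_. borel) X I"
    and "\<And>i. i \<in> I \<Longrightarrow> integrable M (\<lambda>\<omega>. (X i \<omega>)\<^sup>2)"
  shows "variance (\<lambda>\<omega>. \<Sum>i\<in>I. X i \<omega>) = (\<Sum>i\<in>I. variance (X i))"
proof -
  have rv: "random_variable borel (X j)" if "j \<in> I" for j
    using assms(2) that unfolding indep_vars_def2 by blast
  have int: "integrable M (X j)" if "j \<in> I" for j
    using assms(3)[OF that] rv[OF that] by (rule square_integrable_imp_integrable[rotated])
  have "indep_vars (\<lambda>_. borel) (\<lambda>i \<omega>. X i \<omega> - expectation (X i)) I"
    using assms(2) by (rule indep_vars_compose2) auto
  then have "expectation (\<lambda>\<omega>. (\<Sum>i\<in>I. X i \<omega> - expectation (X i))\<^sup>2) = (\<Sum>i\<in>I. variance (X i))"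
    using assms int by (intro expectation_sum_square_indep[THEN conjunct2])
      (auto simp: prob_space power2_diff)
  then show ?thesis
    using int by (simp add: Bochner_Integration.integral_sum sum_subtractf)
qed

lemma variance_le_expectation_square:
  fixes X :: "'a \<Rightarrow> real"
  assumes "integrable M X" "integrable M (\<lambda>\<omega>. (X \<omega>)\<^sup>2)"
  shows "variance X \<le> expectation (\<lambda>\<omega>. (X \<omega>)\<^sup>2)"
  using variance_eq[OF assms] by simp

text \<open>From \<open>(a + b)^2 \<le> 2 * a^2 + 2 * b^2\<close> for the centred variables. The
  asymmetric form fits its use: \<open>X\<close> will be bounded in second moment, whereas for
  \<open>Y\<close>, a sum of independent terms, the variance is under control but the mean need not
  be small.\<close>

lemma variance_add_le:
  fixes X Y :: "'a \<Rightarrow> real"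
  assumes "integrable M X" "integrable M (\<lambda>\<omega>. (X \<omega>)\<^sup>2)" "integrable M Y" "integrable M (\<lambda>\<omega>. (Y \<omega>)\<^sup>2)"
    and XY: "integrable M (\<lambda>\<omega>. (X \<omega> + Y \<omega>)\<^sup>2)"
  shows "variance (\<lambda>\<omega>. X \<omega> + Y \<omega>) \<le> 2 * (expectation (\<lambda>\<omega>. (X \<omega>)\<^sup>2) + variance Y)"
proof -
  have "variance (\<lambda>\<omega>. X \<omega> + Y \<omega>) \<le>
      (\<integral>\<omega>. 2 * ((X \<omega> - expectation X)\<^sup>2 + (Y \<omega> - expectation Y)\<^sup>2) \<partial>M)"
  proof (rule integral_mono)
    show "integrable M (\<lambda>\<omega>. (X \<omega> + Y \<omega> - expectation (\<lambda>\<omega>. X \<omega> + Y \<omega>))\<^sup>2)"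
      unfolding power2_diff using assms by (intro Bochner_Integration.integrable_add Bochner_Integration.integrable_diff) auto
    show "integrable M (\<lambda>\<omega>. 2 * ((X \<omega> - expectation X)\<^sup>2 + (Y \<omega> - expectation Y)\<^sup>2))"
      unfolding power2_diff using assms by (intro Bochner_Integration.integrable_add Bochner_Integration.integrable_diff integrable_mult_right) auto
    fix \<omega>
    have "(X \<omega> + Y \<omega> - expectation (\<lambda>\<omega>. X \<omega> + Y \<omega>))\<^sup>2 = ((X \<omega> - expectation X) + (Y \<omega> - expectation Y))\<^sup>2"
      using assms by (simp add: algebra_simps)
    also have "\<dots> \<le> 2 * ((X \<omega> - expectation X)\<^sup>2 + (Y \<omega> - expectation Y)\<^sup>2)"
      using sum_squares_bound[of "X \<omega> - expectation X" "Y \<omega> - expectation Y"] by (simp add: power2_sum)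
    finally show "(X \<omega> + Y \<omega> - expectation (\<lambda>\<omega>. X \<omega> + Y \<omega>))\<^sup>2
      \<le> 2 * ((X \<omega> - expectation X)\<^sup>2 + (Y \<omega> - expectation Y)\<^sup>2)" .
  qed
  also have "\<dots> = 2 * (variance X + variance Y)"
    unfolding power2_diff using assms by simp
  also have "\<dots> \<le> 2 * (expectation (\<lambda>\<omega>. (X \<omega>)\<^sup>2) + variance Y)"
    using variance_le_expectation_square[of X] assms by simp
  finally show ?thesis .
qed

text \<open>Both steps are weighted Cauchy-Schwarz; the inner one uses the weights \<open>\<rho> ^ (i - j)\<close>, for
  which each term contributes exactly its own weight.\<close>

lemma expectation_square_weighted_products_le:
  fixes q :: "nat \<Rightarrow> 'a \<Rightarrow> real" and w :: "nat \<Rightarrow> real"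
  assumes indep: "indep_vars (\<lambda>_. borel) q UNIV"
    and q: "\<And>i \<omega>. 0 \<le> q i \<omega>" "\<And>i \<omega>. q i \<omega> \<le> 1"
    and contr: "\<And>i. expectation (\<lambda>\<omega>. (q i \<omega>)\<^sup>2) \<le> \<rho>\<^sup>2" and \<rho>: "0 < \<rho>" "\<rho> < 1"
    and w: "\<And>j. 0 \<le> w j"
  shows "expectation (\<lambda>\<omega>. (\<Sum>j<n. w j * (\<Sum>i=j..<n. \<Prod>l=j..<i. q l \<omega>))\<^sup>2)
    \<le> (\<Sum>j<n. w j)\<^sup>2 / (1 - \<rho>)\<^sup>2"
proof -
  define P where "P j i \<omega> = (\<Prod>l=j..<i. q l \<omega>)" for j i \<omega>
  define T where "T j \<omega> = (\<Sum>i=j..<n. P j i \<omega>)" for j \<omega>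
  have [measurable]: "random_variable borel (q i)" for i
    using indep unfolding indep_vars_def2 by blast
  have P01: "0 \<le> P j i \<omega>" "P j i \<omega> \<le> 1" for j i \<omega>
    unfolding P_def using q by (auto intro: prod_nonneg prod_le_1)
  have [measurable]: "random_variable borel (P j i)" for j i unfolding P_def by measurable
  have intP: "integrable M (\<lambda>\<omega>. (P j i \<omega>)\<^sup>2)" for j i
    using P01 by (intro integrable_const_bound[where B=1]) (auto simp: power_le_one_iff power_le_one)
  have EP: "expectation (\<lambda>\<omega>. (P j i \<omega>)\<^sup>2) \<le> \<rho> ^ (2 * (i - j))" for j i
  proof -
    have "expectation (\<lambda>\<omega>. (P j i \<omega>)\<^sup>2) = expectation (\<lambda>\<omega>. \<Prod>l=j..<i. (q l \<omega>)\<^sup>2)"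
      by (simp add: P_def prod_power_distrib)
    also have "\<dots> = (\<Prod>l=j..<i. expectation (\<lambda>\<omega>. (q l \<omega>)\<^sup>2))"
    proof (rule indep_vars_lebesgue_integral)
      show "indep_vars (\<lambda>_. borel) (\<lambda>l \<omega>. (q l \<omega>)\<^sup>2) {j..<i}"
        by (rule indep_vars_compose2[OF indep_vars_subset[OF indep]]) auto
      show "integrable M (\<lambda>\<omega>. (q l \<omega>)\<^sup>2)" for l
        using q by (intro integrable_const_bound[where B=1]) (auto simp: power_le_one)
    qed simp
    also have "\<dots> \<le> (\<Prod>l=j..<i. \<rho>\<^sup>2)" using contr by (intro prod_mono) auto
    finally show ?thesis by (simp add: power_mult)
  qed
  have geo: "(\<Sum>i=j..<n. \<rho> ^ (i - j)) \<le> 1 / (1 - \<rho>)" for j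
  proof -
    have "(\<Sum>i=j..<n. \<rho> ^ (i - j)) = (\<Sum>i<n-j. \<rho> ^ i)"
      by (rule sum.reindex_bij_witness[of _ "\<lambda>i. i + j" "\<lambda>i. i - j"]) auto
    also have "\<dots> = (1 - \<rho> ^ (n - j)) / (1 - \<rho>)" using \<rho> by (simp add: sum_gp_strict)
    also have "\<dots> \<le> 1 / (1 - \<rho>)" using \<rho> by (intro divide_right_mono) auto
    finally show ?thesis .
  qed
  have [measurable]: "random_variable borel (T j)" for j unfolding T_def by measurable
  have T01: "0 \<le> T j \<omega>" "T j \<omega> \<le> n" for j \<omega>
  proof -
    show "0 \<le> T j \<omega>" unfolding T_def using P01 by (intro sum_nonneg)
    have "T j \<omega> \<le> (\<Sum>i=j..<n. 1)" unfolding T_def using P01 by (intro sum_mono) auto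
    then show "T j \<omega> \<le> n" by simp
  qed
  have intT: "integrable M (\<lambda>\<omega>. (T j \<omega>)\<^sup>2)" for j
    using T01 by (intro integrable_const_bound[where B="(real n)\<^sup>2"]) (auto intro: power_mono)
  have ET: "expectation (\<lambda>\<omega>. (T j \<omega>)\<^sup>2) \<le> (1 / (1 - \<rho>))\<^sup>2" for j
  proof -
    define g where "g i = \<rho> ^ (i - j)" for i
    have g: "0 < g i" for i using \<rho> by (simp add: g_def)
    have "(T j \<omega>)\<^sup>2 \<le> (\<Sum>i=j..<n. g i) * (\<Sum>i=j..<n. (P j i \<omega>)\<^sup>2 / g i)" for \<omega>
    proof -
      have "(T j \<omega>)\<^sup>2 = (\<Sum>i=j..<n. g i * (P j i \<omega> / g i))\<^sup>2"
        unfolding T_def using g by (simp add: less_imp_neq[symmetric])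
      also have "\<dots> \<le> (\<Sum>i=j..<n. g i) * (\<Sum>i=j..<n. g i * (P j i \<omega> / g i)\<^sup>2)"
        using g by (intro sum_weighted_square_le) (auto intro: less_imp_le)
      also have "(\<lambda>i. g i * (P j i \<omega> / g i)\<^sup>2) = (\<lambda>i. (P j i \<omega>)\<^sup>2 / g i)"
        using g by (simp add: power2_eq_square less_imp_neq[symmetric])
      finally show ?thesis .
    qed
    then have "expectation (\<lambda>\<omega>. (T j \<omega>)\<^sup>2)
        \<le> expectation (\<lambda>\<omega>. (\<Sum>i=j..<n. g i) * (\<Sum>i=j..<n. (P j i \<omega>)\<^sup>2 / g i))"
      using intP intT by (intro integral_mono) auto
    also have "\<dots> = (\<Sum>i=j..<n. g i) * (\<Sum>i=j..<n. expectation (\<lambda>\<omega>. (P j i \<omega>)\<^sup>2) / g i)"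
      using intP by (simp add: Bochner_Integration.integral_sum)
    also have "\<dots> \<le> (\<Sum>i=j..<n. g i) * (\<Sum>i=j..<n. g i)"
    proof (intro mult_left_mono sum_mono sum_nonneg less_imp_le[OF g])
      fix i
      have "expectation (\<lambda>\<omega>. (P j i \<omega>)\<^sup>2) \<le> g i * g i"
        using EP[of j i] by (simp add: g_def power_mult power2_eq_square power_mult_distrib)
      then show "expectation (\<lambda>\<omega>. (P j i \<omega>)\<^sup>2) / g i \<le> g i" using g[of i] by (simp add: field_simps)
    qed
    also have "\<dots> \<le> (1 / (1 - \<rho>)) * (1 / (1 - \<rho>))"
      using geo[of j] g \<rho> unfolding g_def[symmetric]
      by (intro mult_mono) (auto intro: sum_nonneg less_imp_le)
    finally show ?thesis by (simp add: power2_eq_square)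
  qed
  have "(\<Sum>j<n. w j * T j \<omega>)\<^sup>2 \<le> (\<Sum>j<n. w j) * (\<Sum>j<n. w j * (T j \<omega>)\<^sup>2)" for \<omega>
    using w by (intro sum_weighted_square_le)
  moreover have "integrable M (\<lambda>\<omega>. (\<Sum>j<n. w j * T j \<omega>)\<^sup>2)"
  proof (rule integrable_const_bound[where B="(\<Sum>j<n. w j * n)\<^sup>2"])
    show "AE \<omega> in M. norm ((\<Sum>j<n. w j * T j \<omega>)\<^sup>2) \<le> (\<Sum>j<n. w j * n)\<^sup>2"
      using w T01 by (intro AE_I2) (auto intro!: power_mono sum_mono mult_left_mono sum_nonneg)
  qed simp
  ultimately have "expectation (\<lambda>\<omega>. (\<Sum>j<n. w j * T j \<omega>)\<^sup>2)
      \<le> expectation (\<lambda>\<omega>. (\<Sum>j<n. w j) * (\<Sum>j<n. w j * (T j \<omega>)\<^sup>2))"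
    using intT by (intro integral_mono) auto
  also have "\<dots> = (\<Sum>j<n. w j) * (\<Sum>j<n. w j * expectation (\<lambda>\<omega>. (T j \<omega>)\<^sup>2))"
    using intT by (simp add: Bochner_Integration.integral_sum)
  also have "\<dots> \<le> (\<Sum>j<n. w j) * (\<Sum>j<n. w j * (1 / (1 - \<rho>))\<^sup>2)"
    using w ET by (intro mult_left_mono sum_mono sum_nonneg) auto
  also have "\<dots> = (\<Sum>j<n. w j)\<^sup>2 / (1 - \<rho>)\<^sup>2"
    by (simp add: sum_distrib_right[symmetric] power2_eq_square sum_divide_distrib[symmetric])
  finally show ?thesis by (simp add: T_def P_def)
qed

text \<open>Each \<open>X (f j)\<close> is a function of the family restricted to the block
  \<open>{f j}\<close>, and injectivity makes the blocks disjoint. It serves to shift the demands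
  from indices starting at 1 to indices starting at 0.\<close>

lemma indep_vars_reindex:
  assumes "indep_vars (\<lambda>_. N) X I" and "inj_on f J" and "f ` J \<subseteq> I"
  shows "indep_vars (\<lambda>_. N) (\<lambda>j. X (f j)) J"
proof -
  have "indep_vars (\<lambda>j. PiM {f j} (\<lambda>_. N)) (\<lambda>j \<omega>. restrict (\<lambda>i. X i \<omega>) {f j}) J"
    using assms by (intro indep_vars_restrict) (auto simp: disjoint_family_on_def inj_on_def)
  from indep_vars_compose2[OF this, of "\<lambda>j g. g (f j)" "\<lambda>_. N"] show ?thesis by simp
qed

lemma square_integrable_add:
  fixes X Y :: "'a \<Rightarrow> real"
  assumes [measurable]: "random_variable borel X" "random_variable borel Y"
    and "integrable M (\<lambda>\<omega>. (X \<omega>)\<^sup>2)" "integrable M (\<lambda>\<omega>. (Y \<omega>)\<^sup>2)"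
  shows "integrable M (\<lambda>\<omega>. (X \<omega> + Y \<omega>)\<^sup>2)"
proof (rule Bochner_Integration.integrable_bound)
  show "integrable M (\<lambda>\<omega>. 2 * (X \<omega>)\<^sup>2 + 2 * (Y \<omega>)\<^sup>2)" using assms by simp
  have "(x + y)\<^sup>2 \<le> 2 * x\<^sup>2 + 2 * y\<^sup>2" for x y :: real
    using sum_squares_bound[of x y] by (simp add: power2_sum)
  then show "AE \<omega> in M. norm ((X \<omega> + Y \<omega>)\<^sup>2) \<le> norm (2 * (X \<omega>)\<^sup>2 + 2 * (Y \<omega>)\<^sup>2)"
    by (intro AE_I2) simp
qed simp

section \<open>Characteristic functions and normalization\<close>

text \<open>Rests on \<open>\<bar>exp (i * a) - 1\<bar> \<le> \<bar>a\<bar>\<close> for real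
  \<open>a\<close>, after a factor of modulus 1 has been pulled out.\<close>

lemma char_distr_diff_le:
  fixes X Y :: "'a \<Rightarrow> real"
  assumes [measurable]: "random_variable borel X" "random_variable borel Y"
    and int: "integrable M (\<lambda>\<omega>. X \<omega> - Y \<omega>)"
  shows "cmod (char (distr M borel X) t - char (distr M borel Y) t)
    \<le> \<bar>t\<bar> * expectation (\<lambda>\<omega>. \<bar>X \<omega> - Y \<omega>\<bar>)"
proof -
  have iexp: "integrable M (\<lambda>\<omega>. iexp (t * Z \<omega>))" if [measurable]: "random_variable borel Z" for Z
    using integrable_iexp[of "\<lambda>\<omega>. t * Z \<omega>"] by simp
  have "char (distr M borel X) t - char (distr M borel Y) t
      = (CLINT \<omega>|M. iexp (t * X \<omega>) - iexp (t * Y \<omega>))"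
    by (subst Bochner_Integration.integral_diff[OF iexp iexp]) (simp_all add: char_def integral_distr)
  also have "cmod \<dots> \<le> (\<integral>\<omega>. cmod (iexp (t * X \<omega>) - iexp (t * Y \<omega>)) \<partial>M)"
    by (rule integral_norm_bound)
  also have "\<dots> \<le> (\<integral>\<omega>. \<bar>t\<bar> * \<bar>X \<omega> - Y \<omega>\<bar> \<partial>M)"
  proof (rule integral_mono)
    show "integrable M (\<lambda>\<omega>. cmod (iexp (t * X \<omega>) - iexp (t * Y \<omega>)))"
      by (intro integrable_norm Bochner_Integration.integrable_diff iexp) auto
    show "integrable M (\<lambda>\<omega>. \<bar>t\<bar> * \<bar>X \<omega> - Y \<omega>\<bar>)" using int by simp
    fix \<omega>
    have "iexp (t * X \<omega>) - iexp (t * Y \<omega>) = iexp (t * Y \<omega>) * (iexp (t * (X \<omega> - Y \<omega>)) - 1)"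
      by (simp add: algebra_simps exp_add[symmetric])
    then have "cmod (iexp (t * X \<omega>) - iexp (t * Y \<omega>)) = cmod (iexp (t * (X \<omega> - Y \<omega>)) - 1)"
      by (simp add: norm_mult)
    also have "\<dots> \<le> \<bar>t * (X \<omega> - Y \<omega>)\<bar>"
      using iexp_approx1[of "t * (X \<omega> - Y \<omega>)" 0] by simp
    finally show "cmod (iexp (t * X \<omega>) - iexp (t * Y \<omega>)) \<le> \<bar>t\<bar> * \<bar>X \<omega> - Y \<omega>\<bar>"
      by (simp add: abs_mult)
  qed
  finally show ?thesis by simp
qed

text \<open>An instance of Slutsky's theorem: the characteristic functions differ by a null sequence
  at every \<open>t\<close>, and Levy's continuity theorem turns this back into weak
  convergence.\<close>

lemma weak_conv_m_L1_perturbation: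
  fixes X Y :: "nat \<Rightarrow> 'a \<Rightarrow> real"
  assumes rv: "\<And>n. random_variable borel (X n)" "\<And>n. random_variable borel (Y n)"
    and int: "\<And>n. integrable M (\<lambda>\<omega>. X n \<omega> - Y n \<omega>)"
    and lim: "(\<lambda>n. expectation (\<lambda>\<omega>. \<bar>X n \<omega> - Y n \<omega>\<bar>)) \<longlonglongrightarrow> 0"
    and N: "real_distribution N" and conv: "weak_conv_m (\<lambda>n. distr M borel (X n)) N"
  shows "weak_conv_m (\<lambda>n. distr M borel (Y n)) N"
proof (rule levy_continuity)
  show "real_distribution (distr M borel (Y n))" for n
    using rv(2) by (rule real_distribution_distr)
  fix t
  have X: "(\<lambda>n. char (distr M borel (X n)) t) \<longlonglongrightarrow> char N t"
    by (intro levy_continuity1 conv N real_distribution_distr rv)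
  have "(\<lambda>n. \<bar>t\<bar> * expectation (\<lambda>\<omega>. \<bar>X n \<omega> - Y n \<omega>\<bar>)) \<longlonglongrightarrow> 0"
    using tendsto_mult_left[OF lim, of "\<bar>t\<bar>"] by simp
  then have "(\<lambda>n. char (distr M borel (X n)) t - char (distr M borel (Y n)) t) \<longlonglongrightarrow> 0"
    by (rule Lim_null_comparison[rotated]) (intro always_eventually allI char_distr_diff_le rv int)
  from tendsto_diff[OF X this] show "(\<lambda>n. char (distr M borel (Y n)) t) \<longlonglongrightarrow> char N t" by simp
qed (rule N)

text \<open>A Hilbert space estimate in \<open>L^2\<close>: if \<open>V\<close> is close to
  \<open>U\<close> relative to the norm of \<open>U\<close>, then the two vectors scaled to unit
  length are close as well.\<close>

lemma expectation_square_normalized_diff_le: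
  fixes U V :: "'a \<Rightarrow> real"
  assumes [measurable]: "random_variable borel U" "random_variable borel V"
    and intU: "integrable M (\<lambda>\<omega>. (U \<omega>)\<^sup>2)" and intV: "integrable M (\<lambda>\<omega>. (V \<omega>)\<^sup>2)"
  defines "a \<equiv> expectation (\<lambda>\<omega>. (U \<omega>)\<^sup>2)" and "b \<equiv> expectation (\<lambda>\<omega>. (V \<omega>)\<^sup>2)"
    and "r \<equiv> expectation (\<lambda>\<omega>. (V \<omega> - U \<omega>)\<^sup>2)"
  assumes a: "0 < a" and r: "r \<le> a / 4"
  shows "expectation (\<lambda>\<omega>. (U \<omega> / sqrt a - V \<omega> / sqrt b)\<^sup>2) \<le> 2 * (r / a)"
proof -
  have intUV: "integrable M (\<lambda>\<omega>. U \<omega> * V \<omega>)"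
  proof (rule Bochner_Integration.integrable_bound)
    show "integrable M (\<lambda>\<omega>. (U \<omega>)\<^sup>2 + (V \<omega>)\<^sup>2)" using intU intV by simp
    show "AE \<omega> in M. norm (U \<omega> * V \<omega>) \<le> norm ((U \<omega>)\<^sup>2 + (V \<omega>)\<^sup>2)"
    proof (rule AE_I2)
      fix \<omega>
      have "2 * \<bar>U \<omega>\<bar> * \<bar>V \<omega>\<bar> \<le> (U \<omega>)\<^sup>2 + (V \<omega>)\<^sup>2"
        using sum_squares_bound[of "\<bar>U \<omega>\<bar>" "\<bar>V \<omega>\<bar>"] by simp
      moreover have "0 \<le> \<bar>U \<omega>\<bar> * \<bar>V \<omega>\<bar>" by simp
      ultimately have "\<bar>U \<omega>\<bar> * \<bar>V \<omega>\<bar> \<le> (U \<omega>)\<^sup>2 + (V \<omega>)\<^sup>2" by linarith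
      then show "norm (U \<omega> * V \<omega>) \<le> norm ((U \<omega>)\<^sup>2 + (V \<omega>)\<^sup>2)" by (simp add: abs_mult)
    qed
  qed simp
  define p where "p = expectation (\<lambda>\<omega>. U \<omega> * V \<omega>)"
  have sq: "(V \<omega> - U \<omega>)\<^sup>2 = (V \<omega>)\<^sup>2 + (U \<omega>)\<^sup>2 - 2 * (U \<omega> * V \<omega>)" for \<omega>
    by (simp add: power2_diff)
  have rp: "r = a + b - 2 * p"
    unfolding r_def a_def b_def p_def using intU intV intUV
    by (simp add: sq)
  \<comment> \<open>The norm of \<open>V\<close> must not degenerate:
    \<open>a \<le> 2 * b + 2 * r\<close> with \<open>r \<le> a / 4\<close> gives
    \<open>b \<ge> a / 4\<close>. The pointwise bound below has slack
    \<open>(2 * V - U)^2\<close>.\<close>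
  have "a \<le> (\<integral>\<omega>. 2 * (V \<omega>)\<^sup>2 + 2 * (V \<omega> - U \<omega>)\<^sup>2 \<partial>M)"
    unfolding a_def
  proof (rule integral_mono[OF intU])
    show "integrable M (\<lambda>\<omega>. 2 * (V \<omega>)\<^sup>2 + 2 * (V \<omega> - U \<omega>)\<^sup>2)"
      using intU intV intUV by (simp add: sq)
    show "(U \<omega>)\<^sup>2 \<le> 2 * (V \<omega>)\<^sup>2 + 2 * (V \<omega> - U \<omega>)\<^sup>2" for \<omega>
      using zero_le_power2[of "2 * V \<omega> - U \<omega>"] by (simp add: power2_eq_square algebra_simps)
  qed
  also have "\<dots> = 2 * b + 2 * r"
    unfolding b_def r_def using intU intV intUV
    by (simp add: sq)
  finally have b: "a / 4 \<le> b" using r by simp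
  define x y where "x = sqrt a" and "y = sqrt b"
  have x: "0 < x" "x\<^sup>2 = a" and y: "y\<^sup>2 = b" "x / 2 \<le> y"
    using a b real_sqrt_le_mono[OF b] by (auto simp: x_def y_def real_sqrt_divide)
  have "expectation (\<lambda>\<omega>. (U \<omega> / x - V \<omega> / y)\<^sup>2)
      = (\<integral>\<omega>. (U \<omega>)\<^sup>2 / a + (V \<omega>)\<^sup>2 / b - 2 / (x * y) * (U \<omega> * V \<omega>) \<partial>M)"
    using x y by (intro Bochner_Integration.integral_cong) (auto simp: power2_diff power_divide)
  also have "\<dots> = a / a + b / b - 2 / (x * y) * p"
    using intU intV intUV by (simp add: a_def b_def p_def)
  also have "\<dots> = 2 - 2 * p / (x * y)" using a b by simp
  \<comment> \<open>By polarization \<open>2 * p = x^2 + y^2 - r\<close>, so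
    \<open>2 * x * y - 2 * p\<close> equals \<open>r - (x - y)^2\<close>; the change of length only
    helps.\<close>
  also have "\<dots> = (r - (x - y)\<^sup>2) / (x * y)"
    using x y by (simp add: rp power2_diff field_simps)
  also have "\<dots> \<le> r / (x * y)"
    using x y by (intro divide_right_mono) auto
  also have "\<dots> \<le> r / (a / 2)"
  proof (rule divide_left_mono)
    have "x * (x / 2) \<le> x * y" using y(2) x(1) by (intro mult_left_mono) auto
    then show "a / 2 \<le> x * y" using x(2) by (simp add: power2_eq_square)
    show "0 \<le> r" by (simp add: r_def)
    show "0 < x * y * (a / 2)" using x y a by simp
  qed
  finally show ?thesis by (simp add: x_def y_def mult.commute)
qed

text \<open>Transfers a limit law from \<open>U\<close> to \<open>V\<close>, each divided by its own
  \<open>L^2\<close> norm, when their difference is negligible relative to \<open>U\<close>: the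
  normalized variables are then close in \<open>L^2\<close>, hence in \<open>L^1\<close>.\<close>

lemma weak_conv_m_normalized:
  fixes U V :: "nat \<Rightarrow> 'a \<Rightarrow> real"
  assumes rv [measurable]: "\<And>n. random_variable borel (U n)" "\<And>n. random_variable borel (V n)"
    and intU: "\<And>n. integrable M (\<lambda>\<omega>. (U n \<omega>)\<^sup>2)" and intV: "\<And>n. integrable M (\<lambda>\<omega>. (V n \<omega>)\<^sup>2)"
    and pos: "eventually (\<lambda>n. 0 < expectation (\<lambda>\<omega>. (U n \<omega>)\<^sup>2)) sequentially"
    and lim: "(\<lambda>n. expectation (\<lambda>\<omega>. (V n \<omega> - U n \<omega>)\<^sup>2) / expectation (\<lambda>\<omega>. (U n \<omega>)\<^sup>2)) \<longlonglongrightarrow> 0"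
    and N: "real_distribution N"
    and conv: "weak_conv_m (\<lambda>n. distr M borel (\<lambda>\<omega>. U n \<omega> / sqrt (expectation (\<lambda>\<omega>. (U n \<omega>)\<^sup>2)))) N"
  shows "weak_conv_m (\<lambda>n. distr M borel (\<lambda>\<omega>. V n \<omega> / sqrt (expectation (\<lambda>\<omega>. (V n \<omega>)\<^sup>2)))) N"
proof (rule weak_conv_m_L1_perturbation[OF _ _ _ _ N conv])
  let ?Z = "\<lambda>n \<omega>. U n \<omega> / sqrt (expectation (\<lambda>\<omega>. (U n \<omega>)\<^sup>2)) - V n \<omega> / sqrt (expectation (\<lambda>\<omega>. (V n \<omega>)\<^sup>2))"
  let ?q = "\<lambda>n. expectation (\<lambda>\<omega>. (V n \<omega> - U n \<omega>)\<^sup>2) / expectation (\<lambda>\<omega>. (U n \<omega>)\<^sup>2)"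
  have int1: "integrable M (U n)" "integrable M (V n)" for n
    using intU intV by (auto intro: square_integrable_imp_integrable)
  then show int: "integrable M (?Z n)" for n by simp
  have "eventually (\<lambda>n. ?q n < 1 / 4) sequentially"
    using order_tendstoD(2)[OF lim, of "1/4"] by simp
  with pos have "eventually (\<lambda>n. norm (expectation (\<lambda>\<omega>. \<bar>?Z n \<omega>\<bar>)) \<le> sqrt (2 * ?q n)) sequentially"
  proof eventually_elim
    case (elim n)
    have sq: "expectation (\<lambda>\<omega>. (?Z n \<omega>)\<^sup>2) \<le> 2 * ?q n"
      using elim by (intro expectation_square_normalized_diff_le rv intU intV) (auto simp: field_simps)
    have UV: "integrable M (\<lambda>\<omega>. \<bar>?Z n \<omega>\<bar>\<^sup>2)"
    proof (rule Bochner_Integration.integrable_bound)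
      let ?a = "sqrt (expectation (\<lambda>\<omega>. (U n \<omega>)\<^sup>2))" and ?b = "sqrt (expectation (\<lambda>\<omega>. (V n \<omega>)\<^sup>2))"
      show "integrable M (\<lambda>\<omega>. 2 * (U n \<omega> / ?a)\<^sup>2 + 2 * (V n \<omega> / ?b)\<^sup>2)"
        using intU intV by (simp add: power_divide)
      show "AE \<omega> in M. norm (\<bar>?Z n \<omega>\<bar>\<^sup>2) \<le> norm (2 * (U n \<omega> / ?a)\<^sup>2 + 2 * (V n \<omega> / ?b)\<^sup>2)"
      proof (rule AE_I2)
        fix \<omega>
        have "(x - y)\<^sup>2 \<le> 2 * x\<^sup>2 + 2 * y\<^sup>2" for x y :: real
          using zero_le_power2[of "x + y"] by (simp add: power2_eq_square algebra_simps)
        then show "norm (\<bar>?Z n \<omega>\<bar>\<^sup>2) \<le> norm (2 * (U n \<omega> / ?a)\<^sup>2 + 2 * (V n \<omega> / ?b)\<^sup>2)"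
          by simp
      qed
    qed simp
    \<comment> \<open>Nonnegativity of the variance of \<open>\<bar>?Z n\<bar>\<close> bounds its
      \<open>L^1\<close> norm by its \<open>L^2\<close> norm.\<close>
    have "0 \<le> expectation (\<lambda>\<omega>. \<bar>?Z n \<omega>\<bar>\<^sup>2) - (expectation (\<lambda>\<omega>. \<bar>?Z n \<omega>\<bar>))\<^sup>2"
      unfolding variance_eq[OF integrable_abs[OF int] UV, symmetric] by (rule variance_positive)
    with sq have "(expectation (\<lambda>\<omega>. \<bar>?Z n \<omega>\<bar>))\<^sup>2 \<le> 2 * ?q n" by simp
    then show ?case by (simp add: real_le_rsqrt)
  qed
  moreover have "(\<lambda>n. sqrt (2 * ?q n)) \<longlonglongrightarrow> 0"
    using tendsto_real_sqrt[OF tendsto_mult_left[OF lim, of 2]] by simp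
  ultimately show "(\<lambda>n. expectation (\<lambda>\<omega>. \<bar>?Z n \<omega>\<bar>)) \<longlonglongrightarrow> 0"
    by (rule Lim_null_comparison)
qed simp_all

end

section \<open>Base-stock levels\<close>

text \<open>Translating a candidate \<open>y \<ge> z\<close> by \<open>x - z\<close> gives a
  candidate for \<open>x\<close> whose value differs by at most
  \<open>K * \<bar>x - z\<bar>\<close>. The lower bound on \<open>f\<close> makes the infima
  genuine.\<close>

lemma lipschitz_on_running_infimum:
  fixes f :: "real \<Rightarrow> real"
  assumes lip: "K-lipschitz_on UNIV f" and bdd: "\<And>y. m \<le> f y"
  shows "K-lipschitz_on UNIV (\<lambda>x. INF y\<in>{x..}. f y)"
proof (rule lipschitz_onI)
  show "0 \<le> K" using lip by (rule lipschitz_on_nonneg)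
  have bb: "bdd_below (f ` A)" for A using bdd by (intro bdd_belowI2[of _ m]) auto
  have one: "(INF y\<in>{x..}. f y) - K * \<bar>x - z\<bar> \<le> (INF y\<in>{z..}. f y)" for x z
  proof (rule cINF_greatest)
    fix y assume "y \<in> {z..}"
    then have "(INF y\<in>{x..}. f y) \<le> f (y + (x - z))"
      by (intro cINF_lower bb) auto
    moreover have "\<bar>f (y + (x - z)) - f y\<bar> \<le> K * \<bar>x - z\<bar>"
      using lipschitz_onD[OF lip, of "y + (x - z)" y] by (simp add: dist_real_def)
    ultimately show "(INF y\<in>{x..}. f y) - K * \<bar>x - z\<bar> \<le> f y" by linarith
  qed auto
  show "dist (INF y\<in>{x..}. f y) (INF y\<in>{z..}. f y) \<le> K * dist x z" for x z
    using one[of x z] one[of z x] by (simp add: dist_real_def abs_minus_commute abs_le_iff)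
qed

text \<open>All competition takes place on the compact interval \<open>{a..b}\<close>. To the left
  of \<open>a\<close> the inequality must be strict, so that no minimizer lies there; to the right
  of \<open>b\<close> a weak one is enough, since the smallest minimizer is sought.\<close>

lemma least_arg_min_between:
  fixes g :: "real \<Rightarrow> real"
  assumes cont: "continuous_on UNIV g" and "a \<le> b"
    and below: "\<And>y. y < a \<Longrightarrow> g a < g y" and above: "\<And>y. b < y \<Longrightarrow> g b \<le> g y"
  defines "s \<equiv> (LEAST y. is_arg_min g (\<lambda>y. True) y)"
  shows "\<And>y. g s \<le> g y" and "a \<le> s" and "s \<le> b"
proof -
  obtain m where m: "m \<in> {a..b}" "\<And>y. y \<in> {a..b} \<Longrightarrow> g m \<le> g y"
    using continuous_attains_inf[of "{a..b}" g] continuous_on_subset[OF cont] \<open>a \<le> b\<close>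
    by (metis atLeastAtMost_iff compact_Icc empty_iff order_refl subset_UNIV)
  have gmin: "g m \<le> g y" for y
    using m(2)[of y] m(2)[of a] m(2)[of b] below[of y] above[of y] \<open>a \<le> b\<close>
    by (cases "y < a"; cases "b < y") auto
  have "closed {y. g y \<le> g m}"
    by (intro closed_Collect_le cont continuous_on_const)
  \<comment> \<open>This set consists of the minimizers inside \<open>{a..b}\<close>; compactness
    gives it a least element, without which \<open>LEAST\<close> on the reals would carry no
    information.\<close>
  then have "compact ({a..b} \<inter> {y. g y \<le> g m})"
    by (intro compact_Int_closed) auto
  then obtain t where t: "t \<in> {a..b}" "g t \<le> g m"
    and tmin: "\<And>y. y \<in> {a..b} \<Longrightarrow> g y \<le> g m \<Longrightarrow> t \<le> y"
    using compact_attains_inf[of "{a..b} \<inter> {y. g y \<le> g m}"] m(1)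
    by (metis (mono_tags, lifting) Int_iff empty_iff mem_Collect_eq order_refl)
  have argmin: "is_arg_min g (\<lambda>y. True) y \<longleftrightarrow> g y \<le> g m" for y
    unfolding is_arg_min_linorder using gmin by (auto intro: order_trans)
  have "s = t" unfolding s_def
  proof (rule Least_equality)
    show "is_arg_min g (\<lambda>y. True) t" using t argmin by simp
    fix y assume "is_arg_min g (\<lambda>y. True) y"
    then have y: "g y \<le> g m" by (simp add: argmin)
    have "\<not> y < a" using below[of y] y gmin[of a] by auto
    then show "t \<le> y" using tmin[of y] y t(1) by (cases "y \<le> b") auto
  qed
  then show "\<And>y. g s \<le> g y" "a \<le> s" "s \<le> b" using t gmin by (auto intro: order_trans)
qed

text \<open>Absence of atoms makes the distribution function continuous, so the critical ratio is
  attained exactly at \<open>s_lim\<close>; it also makes demand positive almost surely.\<close>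

locale inventory_model =
  fixes \<psi> :: "real \<Rightarrow> real" and J c c\<^sub>h c\<^sub>p :: real
  assumes real_distribution_demand: "real_distribution (demand_law \<psi>)"
    and demand_bounded: "AE w in demand_law \<psi>. w \<in> {0..J}"
    and demand_no_atom: "\<And>w. measure (demand_law \<psi>) {w} = 0"
    and c_nonneg: "0 \<le> c" and ch_pos: "0 < c\<^sub>h" and c_less: "c < c\<^sub>p"
begin

sublocale demand: real_distribution "demand_law \<psi>"
  by (rule real_distribution_demand)

abbreviation "\<mu> \<equiv> demand_law \<psi>"
abbreviation "L \<equiv> stage_loss c\<^sub>h c\<^sub>p"
abbreviation "v \<equiv> cost_to_go \<psi> c c\<^sub>h c\<^sub>p"
abbreviation "s \<equiv> base_stock \<psi> c c\<^sub>h c\<^sub>p"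
abbreviation "s_lim \<equiv> base_stock_limit \<psi> c\<^sub>h c\<^sub>p"

text \<open>The jump of the slope of \<open>L\<close> at 0, which also serves as a Lipschitz
  constant of \<open>L\<close>.\<close>

definition "K = c\<^sub>h + c\<^sub>p"

lemma cp_pos: "0 < c\<^sub>p" using c_nonneg c_less by linarith

lemma K_pos: "0 < K" using cp_pos ch_pos by (simp add: K_def)

text \<open>Convexity of \<open>L\<close>: the slope of \<open>L (y - w)\<close> in \<open>y\<close>
  is \<open>K * indicator {..y} w - c\<^sub>p\<close>, and an increment lies between the slopes at
  the two ends.\<close>

lemma stage_loss_diff: 
  assumes "y \<le> z"
  shows "L (z - w) - L (y - w) \<le> (z - y) * (K * indicator {..z} w - c\<^sub>p)"
    and "(z - y) * (K * indicator {..y} w - c\<^sub>p) \<le> L (z - w) - L (y - w)"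
proof -
  have 1: "0 \<le> c\<^sub>h * (z - w)" if "w \<le> z" using that ch_pos by simp
  have 2: "0 \<le> c\<^sub>p * (z - w)" if "w \<le> z" using that cp_pos by simp
  have 3: "c\<^sub>h * (y - w) \<le> 0" if "y \<le> w" using that ch_pos by (simp add: mult_le_0_iff)
  have 4: "c\<^sub>p * (y - w) \<le> 0" if "y \<le> w" using that cp_pos by (simp add: mult_le_0_iff)
  show "L (z - w) - L (y - w) \<le> (z - y) * (K * indicator {..z} w - c\<^sub>p)"
    using assms 1 2 3 4 by (auto simp: stage_loss_def indicator_def K_def algebra_simps)
  show "(z - y) * (K * indicator {..y} w - c\<^sub>p) \<le> L (z - w) - L (y - w)"
    using assms 1 2 3 4 by (auto simp: stage_loss_def indicator_def K_def algebra_simps)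
qed

lemma stage_loss_lipschitz: "\<bar>L x - L y\<bar> \<le> K * \<bar>x - y\<bar>"
proof -
  have *: "\<bar>L z - L y\<bar> \<le> K * \<bar>z - y\<bar>" if "y \<le> z" for y z
  proof -
    have "(z - y) * (K * indicator {..z} 0 - c\<^sub>p) \<le> (z - y) * K"
      using that ch_pos cp_pos by (intro mult_left_mono) (auto simp: K_def indicator_def)
    moreover have "(z - y) * (- K) \<le> (z - y) * (K * indicator {..y} 0 - c\<^sub>p)"
      using that ch_pos cp_pos by (intro mult_left_mono) (auto simp: K_def indicator_def)
    ultimately show ?thesis
      using stage_loss_diff[OF that, of 0] that by (simp add: abs_le_iff algebra_simps)
  qed
  show ?thesis
    using *[of x y] *[of y x] by (cases "x \<le> y") (auto simp: abs_minus_commute)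
qed

lemma lipschitz_on_stage_loss: "K-lipschitz_on UNIV L"
  using stage_loss_lipschitz K_pos by (intro lipschitz_onI) (auto simp: dist_real_def)

lemma stage_loss_measurable [measurable]: "L \<in> borel_measurable borel"
  by (intro borel_measurable_continuous_onI lipschitz_on_continuous_on[OF lipschitz_on_stage_loss])

text \<open>Lipschitz functions may be unbounded, but demand lies in \<open>{0..J}\<close>, where
  \<open>f (y - w)\<close> stays within \<open>B * J\<close> of \<open>f y\<close>.\<close>

lemma integrable_shift:
  assumes lip: "B-lipschitz_on UNIV f"
  shows "integrable \<mu> (\<lambda>w. f (y - w) :: real)"
proof (rule demand.integrable_const_bound[where B="\<bar>f y\<bar> + B * J"])
  have [measurable]: "f \<in> borel_measurable borel"
    by (intro borel_measurable_continuous_onI lipschitz_on_continuous_on[OF lip])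
  show "(\<lambda>w. f (y - w)) \<in> borel_measurable \<mu>" by measurable
  show "AE w in \<mu>. norm (f (y - w)) \<le> \<bar>f y\<bar> + B * J"
    using demand_bounded
  proof eventually_elim
    case (elim w)
    have "\<bar>f (y - w) - f y\<bar> \<le> B * \<bar>w\<bar>"
      using lipschitz_onD[OF lip, of "y - w" y] by (simp add: dist_real_def)
    also have "\<dots> \<le> B * J" using elim lipschitz_on_nonneg[OF lip] by (intro mult_left_mono) auto
    finally show ?case by simp
  qed
qed

lemma lipschitz_on_expectation_shift:
  assumes lip: "B-lipschitz_on UNIV f"
  shows "B-lipschitz_on UNIV (\<lambda>y. \<integral>w. f (y - w) \<partial>\<mu> :: real)"
proof (rule lipschitz_onI)
  show "0 \<le> B" using lip by (rule lipschitz_on_nonneg)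
  fix y z
  have "\<bar>(\<integral>w. f (y - w) \<partial>\<mu>) - (\<integral>w. f (z - w) \<partial>\<mu>)\<bar> = \<bar>\<integral>w. f (y - w) - f (z - w) \<partial>\<mu>\<bar>"
    by (simp add: integrable_shift[OF lip])
  also have "\<dots> \<le> (\<integral>w. \<bar>f (y - w) - f (z - w)\<bar> \<partial>\<mu>)" by (rule integral_abs_bound)
  also have "\<dots> \<le> (\<integral>w. B * \<bar>y - z\<bar> \<partial>\<mu>)"
    using lipschitz_onD[OF lip, of "y - w" "z - w" for w]
    by (intro integral_mono) (auto simp: dist_real_def integrable_shift[OF lip])
  finally show "dist (\<integral>w. f (y - w) \<partial>\<mu>) (\<integral>w. f (z - w) \<partial>\<mu>) \<le> B * dist y z"
    by (simp add: dist_real_def demand.prob_space[unfolded demand.space_eq_univ])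
qed

section \<open>Expected loss and the critical quantile\<close>

definition "expected_loss y = (\<integral>w. L (y - w) \<partial>\<mu>)"

lemma cdf_demand_nonpos: "w \<le> 0 \<Longrightarrow> cdf \<mu> w = 0"
proof -
  assume "w \<le> 0"
  then have "cdf \<mu> w \<le> measure \<mu> {0}"
    unfolding cdf_def using demand_bounded
    by (intro demand.finite_measure_mono_AE) (auto elim: eventually_mono)
  then show "cdf \<mu> w = 0" using demand_no_atom[of 0] by (simp add: cdf_def measure_le_0_iff)
qed

lemma bdd_below_quantile_set: "bdd_below {w. c\<^sub>p / (c\<^sub>h + c\<^sub>p) \<le> cdf \<mu> w}"
proof (rule bdd_belowI)
  fix x assume "x \<in> {w. c\<^sub>p / (c\<^sub>h + c\<^sub>p) \<le> cdf \<mu> w}"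
  moreover have "0 < c\<^sub>p / (c\<^sub>h + c\<^sub>p)" using cp_pos ch_pos by simp
  ultimately show "0 \<le> x" using cdf_demand_nonpos[of x] by force
qed

lemma cdf_less_base_stock_limit:
  assumes "w < s_lim" shows "K * cdf \<mu> w < c\<^sub>p"
proof (rule ccontr)
  let ?A = "{w. c\<^sub>p / (c\<^sub>h + c\<^sub>p) \<le> cdf \<mu> w}"
  assume "\<not> ?thesis"
  then have "w \<in> ?A" using K_pos by (simp add: K_def field_simps)
  moreover have "bdd_below ?A" by (rule bdd_below_quantile_set)
  ultimately have "s_lim \<le> w"
    unfolding base_stock_limit_def quantile_def by (intro cInf_lower)
  then show False using assms by simp
qed

text \<open>This is the first-order condition for the expected loss. Continuity of the distribution
  function gives one inequality as a limit from the left, and the other because the infimum of a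
  closed superlevel set belongs to it.\<close>

lemma cdf_base_stock_limit: "K * cdf \<mu> s_lim = c\<^sub>p"
proof (rule antisym)
  let ?A = "{w. c\<^sub>p / (c\<^sub>h + c\<^sub>p) \<le> cdf \<mu> w}"
  have cont: "isCont (cdf \<mu>) w" for w
    using demand_no_atom by (simp add: demand.isCont_cdf)
  have "((\<lambda>w. K * cdf \<mu> w) \<longlongrightarrow> K * cdf \<mu> s_lim) (at_left s_lim)"
    using cont[of "s_lim"] by (intro tendsto_intros) (auto simp: isCont_def filterlim_at_split)
  then show "K * cdf \<mu> s_lim \<le> c\<^sub>p"
  proof (rule tendsto_upperbound)
    show "\<forall>\<^sub>F w in at_left s_lim. K * cdf \<mu> w \<le> c\<^sub>p"
      using cdf_less_base_stock_limit by (auto simp: eventually_at_filter intro!: always_eventually less_imp_le)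
  qed simp
  have "closed ?A"
    using cont by (intro closed_Collect_le continuous_intros) (auto intro: continuous_at_imp_continuous_on)
  moreover have "?A \<noteq> {}"
  proof -
    have "c\<^sub>p / (c\<^sub>h + c\<^sub>p) < 1" using cp_pos ch_pos by simp
    from order_tendstoD(1)[OF demand.cdf_lim_at_top_prob this]
    obtain w where "c\<^sub>p / (c\<^sub>h + c\<^sub>p) < cdf \<mu> w" by (auto simp: eventually_at_top_linorder)
    then show ?thesis by (auto intro: less_imp_le)
  qed
  moreover have "bdd_below ?A" by (rule bdd_below_quantile_set)
  ultimately have "Inf ?A \<in> ?A" by (intro closed_contains_Inf)
  then show "c\<^sub>p \<le> K * cdf \<mu> s_lim"
    using K_pos unfolding base_stock_limit_def quantile_def by (simp add: K_def field_simps)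
qed

lemma base_stock_limit_nonneg: "0 \<le> s_lim"
  using cdf_base_stock_limit cdf_demand_nonpos[of "s_lim"] cp_pos by (cases "0 \<le> s_lim") auto

text \<open>Integrates the slope bounds of \<open>L\<close>;
  \<open>K * cdf \<mu> y - c\<^sub>p\<close> is the derivative of the expected loss.\<close>

lemma expected_loss_diff:
  assumes "y \<le> z"
  shows "expected_loss z - expected_loss y \<le> (z - y) * (K * cdf \<mu> z - c\<^sub>p)"
    and "(z - y) * (K * cdf \<mu> y - c\<^sub>p) \<le> expected_loss z - expected_loss y"
proof -
  note int = integrable_shift[OF lipschitz_on_stage_loss]
  have eq: "expected_loss z - expected_loss y = (\<integral>w. L (z - w) - L (y - w) \<partial>\<mu>)"
    by (simp add: expected_loss_def int)
  have ind: "integrable \<mu> (indicator {..x} :: real \<Rightarrow> real)" for x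
    by (simp add: demand.emeasure_finite less_top[symmetric])
  have lin: "(\<integral>w. (z - y) * (K * indicator {..x} w - c\<^sub>p) \<partial>\<mu>) = (z - y) * (K * cdf \<mu> x - c\<^sub>p)" for x
    using ind by (simp add: cdf_def demand.prob_space[unfolded demand.space_eq_univ])
  show "expected_loss z - expected_loss y \<le> (z - y) * (K * cdf \<mu> z - c\<^sub>p)"
    unfolding eq lin[symmetric] using stage_loss_diff(1)[OF assms]
    by (intro integral_mono) (auto intro!: int ind)
  show "(z - y) * (K * cdf \<mu> y - c\<^sub>p) \<le> expected_loss z - expected_loss y"
    unfolding eq lin[symmetric] using stage_loss_diff(2)[OF assms]
    by (intro integral_mono) (auto intro!: int ind)
qed

lemma expected_loss_strict_decreasing:
  assumes "y < z" "z \<le> s_lim" shows "expected_loss z < expected_loss y"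
proof -
  \<comment> \<open>The slope bound uses the right end of the interval, where it is 0 if
    \<open>z = s_lim\<close>. Cutting at the midpoint gives strict decrease on the first
    half.\<close>
  define t where "t = (y + z) / 2"
  have t: "y < t" "t < z" using assms by (auto simp: t_def)
  have "(t - y) * (K * cdf \<mu> t - c\<^sub>p) < 0"
    using cdf_less_base_stock_limit[of t] t assms by (intro mult_pos_neg) auto
  then have "expected_loss t < expected_loss y" using expected_loss_diff(1)[of y t] t by simp
  moreover have "(z - t) * (K * cdf \<mu> z - c\<^sub>p) \<le> 0"
    using cdf_less_base_stock_limit[of z] cdf_base_stock_limit t assms
    by (cases "z = s_lim") (auto intro!: mult_nonneg_nonpos)
  then have "expected_loss z \<le> expected_loss t" using expected_loss_diff(1)[of t z] t by simp
  ultimately show ?thesis by simp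
qed

lemma expected_loss_above:
  assumes "s_lim \<le> y" shows "expected_loss s_lim \<le> expected_loss y"
  using expected_loss_diff(2)[OF assms] cdf_base_stock_limit by simp

section \<open>The dynamic programming recursion\<close>

text \<open>Indexed by the number of periods left after the current one, so its least minimizer is
  \<open>s (Suc k)\<close>.\<close>

definition "objective k y = c * y + expected_loss y + (\<integral>w. v k (y - w) \<partial>\<mu>)"

lemma base_stock_Suc: "s (Suc k) = (LEAST y. is_arg_min (objective k) (\<lambda>y. True) y)"
  by (simp add: base_stock_def objective_def[abs_def] expected_loss_def)

text \<open>The induction invariant: Lipschitz continuity passes through expectation and running
  infimum, and the minimum is attained inside \<open>{0..s_lim}\<close>, so that \<open>INF\<close>
  and \<open>LEAST\<close> have their intended meaning.\<close>

definition "well_posed k \<longleftrightarrow> (\<exists>B. B-lipschitz_on UNIV (objective k)) \<and>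
    (\<forall>y. objective k (s (Suc k)) \<le> objective k y) \<and> 0 \<le> s (Suc k) \<and> s (Suc k) \<le> s_lim"

lemma lipschitz_on_purchase: "c-lipschitz_on UNIV (\<lambda>y::real. c * y)"
  using c_nonneg by (intro lipschitz_onI) (auto simp: dist_real_def abs_mult right_diff_distrib[symmetric])

lemma lipschitz_on_objective:
  assumes "B-lipschitz_on UNIV (v k)"
  shows "(c + K + B)-lipschitz_on UNIV (objective k)"
  unfolding objective_def[abs_def] expected_loss_def
  by (intro lipschitz_on_add lipschitz_on_expectation_shift assms lipschitz_on_stage_loss lipschitz_on_purchase)

lemma well_posed_0: "well_posed 0"
proof -
  have v0: "0-lipschitz_on UNIV (v 0)" by (auto intro!: lipschitz_onI)
  have obj: "objective 0 y = c * y + expected_loss y" for y by (simp add: objective_def)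
  note lip = lipschitz_on_objective[OF v0]
  \<comment> \<open>Below 0 demand is never covered, so the expected loss has slope
    \<open>- c\<^sub>p\<close> and the objective has slope \<open>c - c\<^sub>p\<close>, which is
    negative.\<close>
  have below: "objective 0 0 < objective 0 y" if "y < 0" for y
  proof -
    have "expected_loss 0 - expected_loss y \<le> (0 - y) * (- c\<^sub>p)"
      using expected_loss_diff(1)[of y 0] that cdf_demand_nonpos[of 0] by simp
    moreover have "(c - c\<^sub>p) * y > 0" using that c_less by (simp add: mult_neg_neg)
    ultimately show ?thesis by (simp add: obj algebra_simps)
  qed
  have above: "objective 0 s_lim \<le> objective 0 y" if "s_lim < y" for y
    using expected_loss_above[of y] that c_nonneg by (simp add: obj add_mono mult_left_mono)
  show ?thesis
    unfolding well_posed_def base_stock_Suc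
    using least_arg_min_between[OF lipschitz_on_continuous_on[OF lip] base_stock_limit_nonneg below above]
      lip by blast
qed

text \<open>The term \<open>- c * x\<close> does not involve \<open>y\<close> and leaves the
  infimum; the minimum of the objective supplies the lower bound that both infima require.\<close>

lemma cost_to_go_Suc:
  assumes "well_posed k"
  shows "v (Suc k) x = (INF y\<in>{x..}. objective k y) - c * x"
proof -
  have bb: "bdd_below (objective k ` {x..})"
    using assms by (intro bdd_belowI2[of _ "objective k (s (Suc k))"]) (auto simp: well_posed_def)
  have "v (Suc k) x = (INF y\<in>{x..}. objective k y + (- c * x))"
    by (simp add: objective_def expected_loss_def algebra_simps)
  also have "\<dots> = (INF y\<in>{x..}. objective k y) + (- c * x)"
  proof (rule antisym)
    have "(INF y\<in>{x..}. objective k y + (- c * x)) - (- c * x) \<le> (INF y\<in>{x..}. objective k y)"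
    proof (rule cINF_greatest)
      fix y assume "y \<in> {x..}"
      moreover have "bdd_below ((\<lambda>y. objective k y + (- c * x)) ` {x..})"
        using assms by (intro bdd_belowI2[of _ "objective k (s (Suc k)) + (- c * x)"]) (auto simp: well_posed_def)
      ultimately have "(INF y\<in>{x..}. objective k y + (- c * x)) \<le> objective k y + (- c * x)"
        by (intro cINF_lower)
      then show "(INF y\<in>{x..}. objective k y + (- c * x)) - (- c * x) \<le> objective k y" by simp
    qed simp
    then show "(INF y\<in>{x..}. objective k y + (- c * x)) \<le> (INF y\<in>{x..}. objective k y) + (- c * x)" by simp
    show "(INF y\<in>{x..}. objective k y) + (- c * x) \<le> (INF y\<in>{x..}. objective k y + (- c * x))"
      using bb by (intro cINF_greatest) (auto intro: cINF_lower)
  qed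
  finally show ?thesis by simp
qed

text \<open>Below \<open>s (Suc k)\<close> one orders up to the same level whatever the inventory, so there the next
  objective is the expected loss plus a constant and still decreases; everywhere, it is the expected
  loss plus a nondecreasing function, which keeps its least minimizer below \<open>s_lim\<close>.\<close>

lemma base_stock_step:
  assumes wp: "well_posed k"
  shows "well_posed (Suc k)" and "s (Suc k) \<le> s (Suc (Suc k))"
proof -
  define a where "a = s (Suc k)"
  define u where "u x = (INF y\<in>{x..}. objective k y)" for x
  have a: "0 \<le> a" "a \<le> s_lim" and amin: "\<And>y. objective k a \<le> objective k y"
    using wp by (auto simp: well_posed_def a_def)
  obtain B where B: "B-lipschitz_on UNIV (objective k)" using wp by (auto simp: well_posed_def)
  have bb: "bdd_below (objective k ` A)" for A
    using amin by (intro bdd_belowI2[of _ "objective k a"])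
  have ulip: "B-lipschitz_on UNIV u"
    unfolding u_def[abs_def] by (rule lipschitz_on_running_infimum[OF B amin])
  have vu: "v (Suc k) x = u x - c * x" for x
    using cost_to_go_Suc[OF wp] by (simp add: u_def)
  have umono: "u x \<le> u y" if "x \<le> y" for x y
    unfolding u_def using that bb by (intro cINF_superset_mono) auto
  have uconst: "u x = objective k a" if "x \<le> a" for x
    unfolding u_def using that amin by (intro antisym cINF_lower2[OF bb] cINF_greatest) auto
  from ulip lipschitz_on_purchase have vlip: "(B + c)-lipschitz_on UNIV (v (Suc k))"
    unfolding vu[abs_def] by (rule lipschitz_on_diff)
  \<comment> \<open>Moving \<open>c * y\<close> under the integral turns the integrand into
    \<open>u (y - w) + c * w\<close>. It inherits monotonicity from \<open>u\<close>, and for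
    \<open>w \<ge> 0\<close> it is constant in \<open>y \<le> a\<close>.\<close>
  define h where "h y = (\<integral>w. v (Suc k) (y - w) + c * y \<partial>\<mu>)" for y
  have hint: "integrable \<mu> (\<lambda>w. v (Suc k) (y - w) + c * y)" for y
    using integrable_shift[OF vlip] by simp
  have obj: "objective (Suc k) y = expected_loss y + h y" for y
    using integrable_shift[OF vlip, of y] unfolding objective_def h_def
    by (simp add: demand.prob_space[unfolded demand.space_eq_univ] del: cost_to_go.simps)
  have hmono: "h y \<le> h z" if "y \<le> z" for y z
    unfolding h_def using that umono
    by (intro integral_mono hint) (auto simp: vu algebra_simps simp del: cost_to_go.simps)
  have hconst: "h y = h a" if "y \<le> a" for y
    unfolding h_def using that
    by (intro integral_cong_AE borel_measurable_integrable hint)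
      (use demand_bounded in \<open>auto elim!: eventually_mono simp: vu uconst algebra_simps simp del: cost_to_go.simps\<close>)
  note lip = lipschitz_on_objective[OF vlip]
  have below: "objective (Suc k) a < objective (Suc k) y" if "y < a" for y
    using expected_loss_strict_decreasing[OF that a(2)] hconst[of y] that by (simp add: obj)
  have above: "objective (Suc k) s_lim \<le> objective (Suc k) y" if "s_lim < y" for y
    using expected_loss_above[of y] hmono[of "s_lim" y] that by (simp add: obj)
  note * = least_arg_min_between[OF lipschitz_on_continuous_on[OF lip] a(2) below above,
      folded base_stock_Suc]
  show "s (Suc k) \<le> s (Suc (Suc k))" using *(2) by (simp add: a_def)
  show "well_posed (Suc k)"
    unfolding well_posed_def using * lip a by (auto intro: order_trans)
qed

lemma well_posed: "well_posed k"
  by (induction k) (auto intro: well_posed_0 base_stock_step)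

lemma base_stock_mono: "i \<le> j \<Longrightarrow> s (Suc i) \<le> s (Suc j)"
  using lift_Suc_mono_le[of "\<lambda>k. s (Suc k)"] base_stock_step(2)[OF well_posed] by blast

lemma base_stock_nonneg: "0 \<le> s (Suc k)" and base_stock_le_limit: "s (Suc k) \<le> s_lim"
  using well_posed[of k] by (auto simp: well_posed_def)

end

section \<open>The cost along a demand path\<close>

context inventory_model
begin

text \<open>From here on periods are counted from 0: period \<open>i + 1\<close> of the paper has index \<open>i\<close>, and its
  base-stock level is \<open>s (n - i)\<close>. For \<open>i \<ge> n\<close> truncated subtraction extends this by \<open>s 1\<close>.\<close>

definition target :: "nat \<Rightarrow> nat \<Rightarrow> real" where
  "target n i = s (Suc (n - Suc i))"

lemma target_antimono: "i \<le> j \<Longrightarrow> target n j \<le> target n i"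
  unfolding target_def by (intro base_stock_mono) auto

lemma target_nonneg: "0 \<le> target n i" and target_le: "target n i \<le> s_lim"
  unfolding target_def by (rule base_stock_nonneg, rule base_stock_le_limit)

abbreviation "X \<equiv> inventory \<psi> c c\<^sub>h c\<^sub>p"

definition "stock n x d i = max (X n x d (Suc i)) (target n i)"

lemma restock_level_inventory:
  "restock_level \<psi> c c\<^sub>h c\<^sub>p n (Suc i) (X n x d (Suc i)) = stock n x d i"
  by (simp add: restock_level_def stock_def target_def)

lemma inventory_Suc_Suc: "X n x d (Suc (Suc i)) = stock n x d i - d (Suc i)"
  using restock_level_inventory[of n i x d] by (simp only: inventory.simps(2)[of _ _ _ _ _ _ _ "Suc i"]) simp

text \<open>Each purchase is the demand of the period plus the increment of the inventory, and the
  increments telescope.\<close>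

lemma realized_cost_eq:
  "realized_cost \<psi> c c\<^sub>h c\<^sub>p n x d =
    (\<Sum>i<n. c * d (Suc i) + L (stock n x d i - d (Suc i))) + c * (X n x d (Suc n) - x)"
proof -
  have "realized_cost \<psi> c c\<^sub>h c\<^sub>p n x d =
    (\<Sum>i<n. c * (stock n x d i - X n x d (Suc i)) + L (X n x d (Suc (Suc i))))"
    unfolding realized_cost_def
    by (rule sum.reindex_bij_witness[of _ Suc "\<lambda>i. i - 1"])
      (auto simp: restock_level_inventory[symmetric] simp del: inventory.simps)
  also have "\<dots> = (\<Sum>i<n. (c * d (Suc i) + L (stock n x d i - d (Suc i))) +
      c * (X n x d (Suc (Suc i)) - X n x d (Suc i)))"
    by (simp add: inventory_Suc_Suc algebra_simps del: inventory.simps)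
  also have "\<dots> = (\<Sum>i<n. c * d (Suc i) + L (stock n x d i - d (Suc i))) +
      c * (\<Sum>i<n. X n x d (Suc (Suc i)) - X n x d (Suc i))"
    by (simp add: sum.distrib sum_distrib_left del: inventory.simps)
  also have "(\<Sum>i<n. X n x d (Suc (Suc i)) - X n x d (Suc i)) = X n x d (Suc n) - x"
    using sum_lessThan_telescope[of "\<lambda>i. X n x d (Suc i)" n] by simp
  finally show ?thesis .
qed

section \<open>The excess over the target levels\<close>

definition "excess n x d i = stock n x d i - target n i"

lemma excess_nonneg: "0 \<le> excess n x d i"
  by (simp add: excess_def stock_def)

text \<open>The start and all targets are at most \<open>s_lim\<close>, and demand only lowers the
  inventory. This confines the excess to the bounded range on which it contracts.\<close>

lemma stock_le_limit:
  assumes "x \<le> s_lim" and "\<And>i. i \<ge> 1 \<Longrightarrow> 0 \<le> d i"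
  shows "stock n x d i \<le> s_lim"
proof (induction i)
  case 0
  then show ?case using assms target_le by (simp add: stock_def)
next
  case (Suc i)
  have "X n x d (Suc (Suc i)) \<le> s_lim"
    using Suc assms(2)[of "Suc i"] by (simp add: inventory_Suc_Suc del: inventory.simps)
  then show ?case using target_le by (simp add: stock_def del: inventory.simps)
qed

text \<open>An excess \<open>t \<in> [0, A]\<close> that meets demand \<open>d\<close> shrinks to \<open>max (t - d) 0 \<le> t * (1 - min A d / A)\<close>
  by concavity of \<open>min t d\<close> in \<open>t\<close>; here \<open>A = s_lim + 1\<close>, which is positive even if \<open>s_lim = 0\<close>.\<close>

definition "retention d = 1 - min (s_lim + 1) (max 0 d) / (s_lim + 1)"

lemma retention_bounds: "0 \<le> retention d" "retention d \<le> 1"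
  using base_stock_limit_nonneg by (auto simp: retention_def field_simps)

lemma excess_Suc_le:
  assumes "x \<le> s_lim" and d: "\<And>i. i \<ge> 1 \<Longrightarrow> 0 \<le> d i"
  shows "excess n x d (Suc i) \<le> (excess n x d i + (target n i - target n (Suc i))) * retention (d (Suc i))"
proof -
  define A where "A = s_lim + 1"
  \<comment> \<open>The excess over the next target before demand is met: the current excess plus
    the drop of the target.\<close>
  define t where "t = stock n x d i - target n (Suc i)"
  have A: "0 < A" using base_stock_limit_nonneg by (simp add: A_def)
  have stock: "stock n x d i \<le> s_lim" using assms by (rule stock_le_limit)
  have t: "0 \<le> t" "t \<le> A"
    using stock target_nonneg[of n "Suc i"] target_antimono[of i "Suc i" n]
      excess_nonneg[of n x d i]
    by (auto simp: t_def A_def excess_def)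
  have "excess n x d (Suc i) = max (t - d (Suc i)) 0"
    by (auto simp: excess_def stock_def[of _ _ _ "Suc i"] inventory_Suc_Suc t_def simp del: inventory.simps)
  also have "\<dots> \<le> t * (1 - min A (d (Suc i)) / A)"
  proof -
    \<comment> \<open>With \<open>m = min A (d (Suc i))\<close>, the bound
      \<open>t * m / A \<le> m\<close> handles the entry \<open>t - d (Suc i)\<close> of the
      maximum, and \<open>t * m / A \<le> t\<close> handles the entry 0.\<close>
    have "t * (m / A) \<le> m" if "0 \<le> m" for m
      using mult_right_mono[OF t(2) that] A by (simp add: pos_divide_le_eq mult.commute)
    from this[of "min A (d (Suc i))"] have "t * (min A (d (Suc i)) / A) \<le> min A (d (Suc i))"
      using A d[of "Suc i"] by (simp only: min.boundedI less_imp_le)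
    moreover have "t * (min A (d (Suc i)) / A) \<le> t * 1"
      using t A by (intro mult_left_mono) auto
    ultimately show ?thesis by (simp add: right_diff_distrib)
  qed
  finally show ?thesis
    using d[of "Suc i"] by (simp add: t_def excess_def retention_def A_def)
qed

text \<open>The excess that enters in period \<open>i\<close>. The starting excess precedes all
  demand, so it can be computed on the zero path, which makes the weights deterministic.\<close>

definition "weight n x i = (target n i - target n (Suc i)) + (if i = 0 then excess n x (\<lambda>_. 0) 0 else 0)"

lemma excess_0: "excess n x d 0 = excess n x (\<lambda>_. 0) 0"
  by (simp add: excess_def stock_def)

lemma weight_nonneg: "0 \<le> weight n x i"
  using target_antimono[of i "Suc i" n] excess_nonneg[of n x "\<lambda>_. 0" 0] by (simp add: weight_def)

text \<open>The drops of the target telescope to at most \<open>s_lim\<close>, and the starting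
  excess adds at most \<open>s_lim\<close>; the total does not grow with \<open>n\<close>.\<close>

lemma sum_weight_le:
  assumes "x \<le> s_lim" shows "(\<Sum>i<n. weight n x i) \<le> 2 * s_lim"
proof -
  have "(\<Sum>i<n. weight n x i) = (target n 0 - target n n)
      + (\<Sum>i<n. if i = 0 then excess n x (\<lambda>_. 0) 0 else 0)"
    unfolding weight_def sum.distrib by (simp add: sum_lessThan_telescope')
  moreover have "(\<Sum>i<n. if i = 0 then excess n x (\<lambda>_. 0) 0 else 0) \<le> s_lim"
    using stock_le_limit[OF assms, of "\<lambda>_. 0" n 0] target_nonneg[of n 0] base_stock_limit_nonneg
    by (simp add: excess_def)
  ultimately show ?thesis using target_le[of n 0] target_nonneg[of n n] by simp
qed

section \<open>Comparison with deterministic stock levels\<close>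

text \<open>The cost with every stock placed exactly at its target. The targets are deterministic,
  so independent demands make the summands independent.\<close>

definition "reference_cost n d = (\<Sum>i<n. c * d (Suc i) + L (target n i - d (Suc i)))"

text \<open>The Lipschitz bound charges \<open>K\<close> per unit of excess, and the unrolled
  recursion bounds the total excess. The last term covers the telescoped purchases: after at least
  one period the final inventory lies between \<open>- J\<close> and \<open>s_lim\<close>.\<close>

lemma realized_cost_reference_diff:
  assumes x: "x \<le> s_lim" and d: "\<And>i. i \<ge> 1 \<Longrightarrow> d i \<in> {0..J}"
  shows "\<bar>realized_cost \<psi> c c\<^sub>h c\<^sub>p n x d - reference_cost n d\<bar> \<le>
     K * (\<Sum>j<n. weight n x j * (\<Sum>i=j..<n. \<Prod>l=j..<i. retention (d (Suc l))))
     + c * (\<bar>x\<bar> + s_lim + J)"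
proof -
  have d0: "\<And>i. i \<ge> 1 \<Longrightarrow> 0 \<le> d i" using d by auto
  have stock: "stock n x d i \<le> s_lim" for i using x d0 by (rule stock_le_limit)
  have excess: "excess n x d (Suc i) \<le>
      (excess n x d i + (target n i - target n (Suc i))) * retention (d (Suc i))" for i
    using x d0 by (rule excess_Suc_le)
  have "\<bar>X n x d (Suc n) - x\<bar> \<le> \<bar>x\<bar> + s_lim + J"
  proof (cases n)
    case 0
    \<comment> \<open>The point \<open>d 1\<close> serves to show \<open>0 \<le> J\<close>.\<close>
    then show ?thesis using base_stock_limit_nonneg d[of 1] by simp
  next
    case (Suc i)
    show ?thesis
      using stock[of i] d[of "Suc i"] excess_nonneg[of n x d i] target_nonneg[of n i]
      unfolding Suc inventory_Suc_Suc excess_def abs_le_iff atLeastAtMost_iff by linarith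
  qed
  then have 1: "\<bar>c * (X n x d (Suc n) - x)\<bar> \<le> c * (\<bar>x\<bar> + s_lim + J)"
    using c_nonneg by (simp add: abs_mult mult_left_mono del: inventory.simps)
  have "\<bar>(\<Sum>i<n. L (stock n x d i - d (Suc i)) - L (target n i - d (Suc i)))\<bar> \<le> (\<Sum>i<n. K * excess n x d i)"
    using stage_loss_lipschitz[of "stock n x d i - d (Suc i)" "target n i - d (Suc i)" for i] excess_nonneg[of n x d]
    by (intro order_trans[OF sum_abs] sum_mono) (simp add: excess_def)
  also have "\<dots> = K * (\<Sum>i<n. excess n x d i)" by (simp add: sum_distrib_left)
  also have "(\<Sum>i<n. excess n x d i) \<le>
      (\<Sum>j<n. (target n j - target n (Suc j) + (if j = 0 then excess n x d 0 else 0))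
         * (\<Sum>i=j..<n. \<Prod>l=j..<i. retention (d (Suc l))))"
    using excess target_antimono[of i "Suc i" n for i] retention_bounds
    by (intro sum_contracting_recursion_le) auto
  also have "\<dots> = (\<Sum>j<n. weight n x j * (\<Sum>i=j..<n. \<Prod>l=j..<i. retention (d (Suc l))))"
    by (simp add: weight_def excess_0[of n x d] cong: if_cong)
  finally have "\<bar>(\<Sum>i<n. L (stock n x d i - d (Suc i)) - L (target n i - d (Suc i)))\<bar>
     \<le> K * (\<Sum>j<n. weight n x j * (\<Sum>i=j..<n. \<Prod>l=j..<i. retention (d (Suc l))))"
    using K_pos by simp
  moreover have "realized_cost \<psi> c c\<^sub>h c\<^sub>p n x d - reference_cost n d =
     (\<Sum>i<n. L (stock n x d i - d (Suc i)) - L (target n i - d (Suc i))) + c * (X n x d (Suc n) - x)"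
    unfolding realized_cost_eq reference_cost_def by (simp add: sum.distrib sum_subtractf)
  ultimately show ?thesis using 1 by linarith
qed

section \<open>The stationary level and its cost\<close>

definition "stationary_stock = (SUP k. s (Suc k))"

lemma base_stock_tendsto: "(\<lambda>k. s (Suc k)) \<longlonglongrightarrow> stationary_stock"
  unfolding stationary_stock_def
  using base_stock_mono base_stock_le_limit
  by (intro LIMSEQ_incseq_SUP) (auto simp: incseq_def intro!: bdd_aboveI2[where M="s_lim"])

lemma stationary_stock_le: "stationary_stock \<le> s_lim"
  using base_stock_tendsto by (rule LIMSEQ_le_const2) (auto intro: base_stock_le_limit)

lemma stationary_stock_nonneg: "0 \<le> stationary_stock"
  using base_stock_tendsto by (rule LIMSEQ_le_const) (auto intro: base_stock_nonneg)

definition "stationary_cost w = c * w + L (stationary_stock - w)"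

lemma stationary_cost_measurable [measurable]: "stationary_cost \<in> borel_measurable borel"
  unfolding stationary_cost_def[abs_def] by measurable

text \<open>Above the stationary base stock the cost is strictly increasing, and that half-line carries
  positive mass without atoms, so the cost of a period is not almost surely constant.\<close>

lemma stationary_cost_not_AE_const: "\<not> (AE w in \<mu>. stationary_cost w = m)"
proof
  assume const: "AE w in \<mu>. stationary_cost w = m"
  \<comment> \<open>For \<open>w > s_lim\<close> the cost is
    \<open>c * w + c\<^sub>p * (w - stationary_stock)\<close>; \<open>w0\<close> is the only point
    where this affine function equals \<open>m\<close>.\<close>
  define w0 where "w0 = (m + c\<^sub>p * stationary_stock) / (c + c\<^sub>p)"
  have "AE w in \<mu>. w \<le> s_lim \<or> w = w0"
    using const
  proof eventually_elim
    case (elim w)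
    show ?case
    proof (cases "w \<le> s_lim")
      case False
      then have "c * w + c\<^sub>p * (w - stationary_stock) = m"
        using elim stationary_stock_le by (auto simp: stationary_cost_def stage_loss_def algebra_simps)
      then have "(c + c\<^sub>p) * w = m + c\<^sub>p * stationary_stock" by (simp add: algebra_simps)
      moreover have "c + c\<^sub>p \<noteq> 0" using cp_pos c_nonneg by linarith
      ultimately show ?thesis by (simp add: w0_def field_simps)
    qed simp
  qed
  then have "AE w in \<mu>. w \<in> {..s_lim} \<union> {w0}" by (auto elim: eventually_mono)
  then have "measure \<mu> ({..s_lim} \<union> {w0}) = 1" by (subst demand.prob_eq_1) auto
  moreover have "measure \<mu> ({..s_lim} \<union> {w0}) \<le> measure \<mu> {..s_lim} + measure \<mu> {w0}"
    by (intro measure_Un_le) auto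
  ultimately have "1 \<le> cdf \<mu> s_lim" using demand_no_atom[of w0] by (simp add: cdf_def)
  then have "K \<le> c\<^sub>p" using cdf_base_stock_limit mult_left_mono[of 1 "cdf \<mu> s_lim" K] K_pos by simp
  then show False using ch_pos by (simp add: K_def)
qed

lemma retention_measurable [measurable]: "retention \<in> borel_measurable borel"
  unfolding retention_def[abs_def] by measurable

text \<open>Demand is almost surely positive, so the retained fraction is almost surely below 1, and
  strictness survives integration.\<close>

lemma expectation_retention_square_less: "(\<integral>w. (retention w)\<^sup>2 \<partial>\<mu>) < 1"
proof (rule demand.expectation_less)
  show "integrable \<mu> (\<lambda>w. (retention w)\<^sup>2)"
    using retention_bounds by (intro demand.integrable_const_bound[where B=1]) (auto simp: power_le_one)
  have "AE w in \<mu>. w \<noteq> 0"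
    using demand_no_atom[of 0] by (intro AE_I[of _ _ "{0}"]) (auto simp: demand.emeasure_eq_measure)
  with demand_bounded show "AE w in \<mu>. (retention w)\<^sup>2 < 1"
  proof eventually_elim
    case (elim w)
    then have "retention w < 1" using base_stock_limit_nonneg by (auto simp: retention_def)
    then show ?case using retention_bounds[of w] by (simp add: power2_less_1_iff abs_less_iff abs_if)
  qed
qed

end

section \<open>The central limit theorem\<close>

locale inventory_process = inventory_model + prob_space M for M :: "'a measure" +
  fixes D :: "nat \<Rightarrow> 'a \<Rightarrow> real" and x :: real
  assumes indep_demands: "indep_vars (\<lambda>_. borel) D {1..}"
    and demand_distr: "\<And>i. i \<ge> 1 \<Longrightarrow> distr M borel (D i) = \<mu>"
    and initial_le: "x \<le> s_lim"
begin

lemma demand_rv [measurable]: "random_variable borel (D (Suc i))"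
  using indep_demands unfolding indep_vars_def2 by auto

lemma indep_demands_Suc: "indep_vars (\<lambda>_. borel) (\<lambda>i. D (Suc i)) UNIV"
  by (rule indep_vars_reindex[OF indep_demands]) auto

lemma AE_demand: assumes "AE w in \<mu>. P w" and [measurable]: "Measurable.pred borel P"
  shows "AE \<omega> in M. P (D (Suc i) \<omega>)"
  using assms(1) unfolding demand_distr[of "Suc i", simplified, symmetric]
  by (subst (asm) AE_distr_iff) (auto simp: pred_def)

text \<open>Countably many null sets are discarded together, so that the pathwise estimates apply to
  almost every \<open>\<omega>\<close>.\<close>

lemma AE_path: "AE \<omega> in M. \<forall>i\<ge>1. D i \<omega> \<in> {0..J}"
proof -
  have "AE \<omega> in M. \<forall>i. D (Suc i) \<omega> \<in> {0..J}"
    unfolding AE_all_countable by (intro allI AE_demand demand_bounded) measurable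
  then show ?thesis
    by eventually_elim (metis One_nat_def Suc_le_D)
qed

lemma expectation_demand:
  assumes [measurable]: "f \<in> borel_measurable borel"
  shows "expectation (\<lambda>\<omega>. f (D (Suc i) \<omega>)) = (\<integral>w. f w \<partial>\<mu> :: real)"
  using demand_distr[of "Suc i"] by (simp flip: integral_distr[of "D (Suc i)" M borel])

lemma integrable_bounded_demand:
  assumes [measurable]: "f \<in> borel_measurable borel"
    and bound: "\<And>w. w \<in> {0..J} \<Longrightarrow> \<bar>f w\<bar> \<le> B"
  shows "integrable M (\<lambda>\<omega>. f (D (Suc i) \<omega>) :: real)"
    and "integrable M (\<lambda>\<omega>. (f (D (Suc i) \<omega>))\<^sup>2)"
proof -
  have B: "AE \<omega> in M. \<bar>f (D (Suc i) \<omega>)\<bar> \<le> B"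
    using AE_path by eventually_elim (auto intro: bound)
  then show "integrable M (\<lambda>\<omega>. f (D (Suc i) \<omega>))"
    by (intro integrable_const_bound[where B=B]) auto
  have "AE \<omega> in M. norm ((f (D (Suc i) \<omega>))\<^sup>2) \<le> B\<^sup>2"
    using B by eventually_elim (auto intro: abs_le_square_iff[THEN iffD1, OF order_trans[OF _ abs_ge_self]])
  then show "integrable M (\<lambda>\<omega>. (f (D (Suc i) \<omega>))\<^sup>2)"
    by (rule integrable_const_bound) simp
qed

lemma stock_rv [measurable]: "random_variable borel (\<lambda>\<omega>. stock n x (\<lambda>i. D i \<omega>) i)"
proof (induction i)
  case (Suc i)
  note [measurable] = Suc
  have "random_variable borel (\<lambda>\<omega>. max (stock n x (\<lambda>i. D i \<omega>) i - D (Suc i) \<omega>) (target n (Suc i)))"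
    by measurable
  then show ?case by (simp add: stock_def[of _ _ _ "Suc i"] inventory_Suc_Suc del: inventory.simps)
qed (simp add: stock_def)

lemma inventory_rv [measurable]: "random_variable borel (\<lambda>\<omega>. X n x (\<lambda>i. D i \<omega>) (Suc i))"
proof (cases i)
  case (Suc j)
  show ?thesis unfolding Suc inventory_Suc_Suc by measurable
qed simp

section \<open>Random costs and their second moments\<close>

definition "cost n \<omega> = realized_cost \<psi> c c\<^sub>h c\<^sub>p n x (\<lambda>i. D i \<omega>)"
definition "reference n \<omega> = reference_cost n (\<lambda>i. D i \<omega>)"
definition "stationary_sum n \<omega> = (\<Sum>i<n. stationary_cost (D (Suc i) \<omega>))"
definition "target_gap n i w = L (target n i - w) - L (stationary_stock - w)"

lemma cost_rv [measurable]: "random_variable borel (cost n)"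
  unfolding cost_def[abs_def] realized_cost_eq by measurable

lemma reference_rv [measurable]: "random_variable borel (reference n)"
  unfolding reference_def[abs_def] reference_cost_def by measurable

lemma stationary_sum_rv [measurable]: "random_variable borel (stationary_sum n)"
  unfolding stationary_sum_def[abs_def] by measurable

lemma target_gap_measurable [measurable]: "target_gap n i \<in> borel_measurable borel"
  unfolding target_gap_def[abs_def] by measurable

lemma target_gap_bound: "\<bar>target_gap n i w\<bar> \<le> K * \<bar>target n i - stationary_stock\<bar>"
  using stage_loss_lipschitz[of "target n i - w" "stationary_stock - w"] by (simp add: target_gap_def)

lemma reference_eq: "reference n \<omega> = (\<Sum>i<n. target_gap n i (D (Suc i) \<omega>)) + stationary_sum n \<omega>"
  unfolding reference_def reference_cost_def target_gap_def stationary_sum_def stationary_cost_def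
    sum.distrib[symmetric]
  by (intro sum.cong refl) simp

lemma stationary_cost_bound:
  assumes "w \<in> {0..J}" shows "\<bar>stationary_cost w\<bar> \<le> c * J + K * (stationary_stock + J)"
proof -
  have "\<bar>L (stationary_stock - w)\<bar> \<le> K * \<bar>stationary_stock - w\<bar>"
    using stage_loss_lipschitz[of "stationary_stock - w" 0] by (simp add: stage_loss_def)
  also have "\<dots> \<le> K * (stationary_stock + J)"
    using K_pos assms stationary_stock_nonneg by (intro mult_left_mono) auto
  moreover have "\<bar>c * w\<bar> \<le> c * J" using c_nonneg assms by (simp add: abs_mult mult_left_mono)
  ultimately show ?thesis unfolding stationary_cost_def by linarith
qed

lemmas integrable_stationary_cost =
  integrable_bounded_demand[OF stationary_cost_measurable stationary_cost_bound]

lemmas integrable_target_gap =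
  integrable_bounded_demand[OF target_gap_measurable target_gap_bound]

lemma square_integrable_sum_bounded:
  assumes [measurable]: "\<And>i. f i \<in> borel_measurable borel"
    and bound: "\<And>i w. w \<in> {0..J} \<Longrightarrow> \<bar>f i w\<bar> \<le> B i"
  shows "integrable M (\<lambda>\<omega>. (\<Sum>i<n. f i (D (Suc i) \<omega>))\<^sup>2 :: real)"
proof (induction n)
  case (Suc n)
  then show ?case
    using integrable_bounded_demand(2)[OF assms(1) bound, of n n]
    by (auto intro!: square_integrable_add)
qed simp

text \<open>Independence makes the variances add, and each gap is bounded by the Lipschitz estimate
  uniformly in the demand.\<close>

lemma variance_reference_gap_le:
  "variance (\<lambda>\<omega>. \<Sum>i<n. target_gap n i (D (Suc i) \<omega>))
    \<le> (\<Sum>k<n. K\<^sup>2 * (s (Suc k) - stationary_stock)\<^sup>2)"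
proof -
  have "variance (\<lambda>\<omega>. \<Sum>i<n. target_gap n i (D (Suc i) \<omega>))
      = (\<Sum>i<n. variance (\<lambda>\<omega>. target_gap n i (D (Suc i) \<omega>)))"
  proof (rule variance_sum_indep)
    show "indep_vars (\<lambda>_. borel) (\<lambda>i \<omega>. target_gap n i (D (Suc i) \<omega>)) {..<n}"
      by (rule indep_vars_compose2[OF indep_vars_subset[OF indep_demands_Suc]]) auto
  qed (auto intro: integrable_target_gap)
  also have "\<dots> \<le> (\<Sum>i<n. K\<^sup>2 * (target n i - stationary_stock)\<^sup>2)"
  proof (rule sum_mono)
    fix i
    have "(target_gap n i w)\<^sup>2 \<le> K\<^sup>2 * (target n i - stationary_stock)\<^sup>2" for w
      using power_mono[OF target_gap_bound[of n i w], of 2] by (simp add: power_mult_distrib)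
    then have "expectation (\<lambda>\<omega>. (target_gap n i (D (Suc i) \<omega>))\<^sup>2)
        \<le> expectation (\<lambda>\<omega>. K\<^sup>2 * (target n i - stationary_stock)\<^sup>2)"
      by (intro integral_mono integrable_target_gap) auto
    then show "variance (\<lambda>\<omega>. target_gap n i (D (Suc i) \<omega>)) \<le> K\<^sup>2 * (target n i - stationary_stock)\<^sup>2"
      using variance_le_expectation_square[OF integrable_target_gap, of n i i] by (simp add: prob_space)
  qed
  \<comment> \<open>Reversing time indexes the terms by the periods remaining, which removes the
    dependence of the summands on \<open>n\<close> and prepares the Cesaro mean.\<close>
  also have "\<dots> = (\<Sum>k<n. K\<^sup>2 * (s (Suc k) - stationary_stock)\<^sup>2)"
    unfolding target_def by (rule sum.nat_diff_reindex)
  finally show ?thesis .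
qed

text \<open>Inserts independent retention factors into the pathwise estimate. The bound is uniform
  in \<open>n\<close> because the sum of the weights and the contraction rate are.\<close>

lemma cost_reference_square:
  "\<exists>B. \<forall>n. integrable M (\<lambda>\<omega>. (cost n \<omega> - reference n \<omega>)\<^sup>2) \<and>
    expectation (\<lambda>\<omega>. (cost n \<omega> - reference n \<omega>)\<^sup>2) \<le> B"
proof -
  define q where "q i \<omega> = retention (D (Suc i) \<omega>)" for i \<omega>
  \<comment> \<open>The maximum with \<open>1 / 4\<close> guarantees \<open>0 < \<rho>\<close>, as
    the geometric weights require; any constant strictly between 0 and 1 would do.\<close>
  define \<rho> where "\<rho> = sqrt (max (1 / 4) (\<integral>w. (retention w)\<^sup>2 \<partial>\<mu>))"
  define S where "S n \<omega> = (\<Sum>j<n. weight n x j * (\<Sum>i=j..<n. \<Prod>l=j..<i. q l \<omega>))" for n \<omega>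
  define b where "b = c * (\<bar>x\<bar> + s_lim + J)"
  define B where "B = 2 * K\<^sup>2 * ((2 * s_lim)\<^sup>2 / (1 - \<rho>)\<^sup>2) + 2 * b\<^sup>2"
  have "0 \<le> (\<integral>w. (retention w)\<^sup>2 \<partial>\<mu>)" by simp
  then have \<rho>: "0 < \<rho>" "\<rho> < 1" "(\<integral>w. (retention w)\<^sup>2 \<partial>\<mu>) \<le> \<rho>\<^sup>2"
    using expectation_retention_square_less by (auto simp: \<rho>_def)
  have [measurable]: "random_variable borel (q i)" for i unfolding q_def by measurable
  have Srv [measurable]: "random_variable borel (S n)" for n unfolding S_def by measurable
  have Sq: "expectation (\<lambda>\<omega>. (S n \<omega>)\<^sup>2) \<le> (\<Sum>j<n. weight n x j)\<^sup>2 / (1 - \<rho>)\<^sup>2" for n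
    unfolding S_def
  proof (rule expectation_square_weighted_products_le)
    show "indep_vars (\<lambda>_. borel) q UNIV"
      unfolding q_def by (rule indep_vars_compose2[OF indep_demands_Suc]) auto
    show "expectation (\<lambda>\<omega>. (q i \<omega>)\<^sup>2) \<le> \<rho>\<^sup>2" for i
      using \<rho> expectation_demand[of "\<lambda>w. (retention w)\<^sup>2" i] by (simp add: q_def)
  qed (use \<rho> retention_bounds weight_nonneg in \<open>auto simp: q_def\<close>)
  have "(\<Sum>j<n. weight n x j)\<^sup>2 / (1 - \<rho>)\<^sup>2 \<le> (2 * s_lim)\<^sup>2 / (1 - \<rho>)\<^sup>2" for n
    using sum_weight_le[OF initial_le] weight_nonneg
    by (intro divide_right_mono power_mono sum_nonneg) auto
  with Sq have ES: "expectation (\<lambda>\<omega>. (S n \<omega>)\<^sup>2) \<le> (2 * s_lim)\<^sup>2 / (1 - \<rho>)\<^sup>2" for n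
    by (rule order_trans)
  have intS: "integrable M (\<lambda>\<omega>. (S n \<omega>)\<^sup>2)" for n
  proof (rule integrable_const_bound[where B="(\<Sum>j<n. weight n x j * (\<Sum>i=j..<n. 1))\<^sup>2"])
    have "0 \<le> S n \<omega> \<and> S n \<omega> \<le> (\<Sum>j<n. weight n x j * (\<Sum>i=j..<n. 1))" for \<omega>
      unfolding S_def q_def using retention_bounds weight_nonneg
      by (intro conjI sum_nonneg sum_mono mult_left_mono mult_nonneg_nonneg prod_nonneg prod_le_1 ballI) auto
    then show "AE \<omega> in M. norm ((S n \<omega>)\<^sup>2) \<le> (\<Sum>j<n. weight n x j * (\<Sum>i=j..<n. 1))\<^sup>2"
      by (intro AE_I2) (simp add: power_mono)
  qed simp
  have bound: "AE \<omega> in M. (cost n \<omega> - reference n \<omega>)\<^sup>2 \<le> 2 * K\<^sup>2 * (S n \<omega>)\<^sup>2 + 2 * b\<^sup>2" for n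
    using AE_path
  proof eventually_elim
    case (elim \<omega>)
    have "\<bar>cost n \<omega> - reference n \<omega>\<bar> \<le> K * S n \<omega> + b"
      unfolding cost_def reference_def S_def q_def b_def using elim
      by (intro realized_cost_reference_diff initial_le) auto
    from power_mono[OF this, of 2] have "(cost n \<omega> - reference n \<omega>)\<^sup>2 \<le> (K * S n \<omega> + b)\<^sup>2" by simp
    also have "\<dots> \<le> 2 * K\<^sup>2 * (S n \<omega>)\<^sup>2 + 2 * b\<^sup>2"
      using sum_squares_bound[of "K * S n \<omega>" b] by (simp add: power2_eq_square algebra_simps)
    finally show ?case .
  qed
  have intB: "integrable M (\<lambda>\<omega>. 2 * K\<^sup>2 * (S n \<omega>)\<^sup>2 + 2 * b\<^sup>2)" for n using intS by simp
  have int: "integrable M (\<lambda>\<omega>. (cost n \<omega> - reference n \<omega>)\<^sup>2)" for n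
    by (rule Bochner_Integration.integrable_bound[OF intB[of n]])
      (use bound[of n] in \<open>auto elim: eventually_mono\<close>)
  have "expectation (\<lambda>\<omega>. (cost n \<omega> - reference n \<omega>)\<^sup>2) \<le> B" for n
  proof -
    have "expectation (\<lambda>\<omega>. (cost n \<omega> - reference n \<omega>)\<^sup>2)
        \<le> expectation (\<lambda>\<omega>. 2 * K\<^sup>2 * (S n \<omega>)\<^sup>2 + 2 * b\<^sup>2)"
      by (intro integral_mono_AE int intB bound)
    also have "\<dots> = 2 * K\<^sup>2 * expectation (\<lambda>\<omega>. (S n \<omega>)\<^sup>2) + 2 * b\<^sup>2"
      using intS by (simp add: prob_space)
    also have "\<dots> \<le> B" unfolding B_def using ES by (intro add_mono mult_left_mono) auto
    finally show ?thesis .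
  qed
  with int show ?thesis by blast
qed

section \<open>The limit law of the stationary cost\<close>

definition "stationary_mean = (\<integral>w. stationary_cost w \<partial>\<mu>)"
definition "stationary_variance = (\<integral>w. (stationary_cost w - stationary_mean)\<^sup>2 \<partial>\<mu>)"

lemma expectation_stationary_cost: "expectation (\<lambda>\<omega>. stationary_cost (D (Suc i) \<omega>)) = stationary_mean"
  unfolding stationary_mean_def by (rule expectation_demand) measurable

lemma variance_stationary_cost: "variance (\<lambda>\<omega>. stationary_cost (D (Suc i) \<omega>)) = stationary_variance"
  unfolding expectation_stationary_cost stationary_variance_def
  by (rule expectation_demand[of "\<lambda>w. (stationary_cost w - stationary_mean)\<^sup>2"]) measurable

text \<open>Zero variance would make the stationary cost almost surely equal to its mean.\<close>

lemma stationary_variance_pos: "0 < stationary_variance"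
proof -
  have int: "integrable \<mu> (\<lambda>w. (stationary_cost w - stationary_mean)\<^sup>2)"
  proof (rule demand.integrable_const_bound[where B="(c * J + K * (stationary_stock + J) + \<bar>stationary_mean\<bar>)\<^sup>2"])
    show "AE w in \<mu>. norm ((stationary_cost w - stationary_mean)\<^sup>2)
        \<le> (c * J + K * (stationary_stock + J) + \<bar>stationary_mean\<bar>)\<^sup>2"
      using demand_bounded
    proof eventually_elim
      case (elim w)
      have "\<bar>stationary_cost w - stationary_mean\<bar> \<le> c * J + K * (stationary_stock + J) + \<bar>stationary_mean\<bar>"
        using stationary_cost_bound[OF elim] by linarith
      from power_mono[OF this, of 2] show ?case by simp
    qed
  qed simp
  have "stationary_variance \<noteq> 0"
  proof
    assume "stationary_variance = 0"
    then have "AE w in \<mu>. (stationary_cost w - stationary_mean)\<^sup>2 = 0"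
      unfolding stationary_variance_def using int by (subst (asm) integral_nonneg_eq_0_iff_AE) auto
    then show False using stationary_cost_not_AE_const[of stationary_mean] by simp
  qed
  moreover have "0 \<le> stationary_variance" unfolding stationary_variance_def by simp
  ultimately show ?thesis by simp
qed

lemma stationary_sum_clt:
  "weak_conv_m (\<lambda>n. distr M borel (\<lambda>\<omega>. (stationary_sum n \<omega> - n * stationary_mean) / sqrt (n * stationary_variance)))
     std_normal_distribution"
proof -
  have "weak_conv_m (\<lambda>n. distr M borel (\<lambda>\<omega>. (\<Sum>i<n. stationary_cost (D (Suc i) \<omega>) - stationary_mean)
      / sqrt (n * (sqrt stationary_variance)\<^sup>2))) std_normal_distribution"
  proof (rule central_limit_theorem)
    show "indep_vars (\<lambda>_. borel) (\<lambda>i \<omega>. stationary_cost (D (Suc i) \<omega>)) UNIV"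
      by (rule indep_vars_compose2[OF indep_demands_Suc]) auto
    show "variance (\<lambda>\<omega>. stationary_cost (D (Suc n) \<omega>)) = (sqrt stationary_variance)\<^sup>2" for n
      using stationary_variance_pos by (simp add: variance_stationary_cost)
    show "distr M borel (\<lambda>\<omega>. stationary_cost (D (Suc n) \<omega>)) = distr \<mu> borel stationary_cost" for n
      using demand_distr[of "Suc n"] distr_distr[of stationary_cost borel borel "D (Suc n)" M]
      by (simp add: comp_def)
  qed (use stationary_variance_pos in \<open>auto simp: expectation_stationary_cost intro: integrable_stationary_cost\<close>)
  then show ?thesis
    using stationary_variance_pos by (simp add: stationary_sum_def sum_subtractf)
qed

lemma square_integrable_stationary_sum: "integrable M (\<lambda>\<omega>. (stationary_sum n \<omega>)\<^sup>2)"
  unfolding stationary_sum_def by (rule square_integrable_sum_bounded[OF _ stationary_cost_bound]) auto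

lemma square_integrable_target_gap_sum:
  "integrable M (\<lambda>\<omega>. (\<Sum>i<n. target_gap n i (D (Suc i) \<omega>))\<^sup>2)"
  by (rule square_integrable_sum_bounded[OF _ target_gap_bound]) auto

lemma expectation_stationary_sum: "expectation (stationary_sum n) = n * stationary_mean"
  unfolding stationary_sum_def
  by (subst Bochner_Integration.integral_sum)
    (auto simp: expectation_stationary_cost intro: integrable_stationary_cost)

lemma variance_stationary_sum: "variance (stationary_sum n) = n * stationary_variance"
proof -
  have "variance (stationary_sum n) = (\<Sum>i<n. variance (\<lambda>\<omega>. stationary_cost (D (Suc i) \<omega>)))"
    unfolding stationary_sum_def
  proof (rule variance_sum_indep)
    show "indep_vars (\<lambda>_. borel) (\<lambda>i \<omega>. stationary_cost (D (Suc i) \<omega>)) {..<n}"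
      by (rule indep_vars_compose2[OF indep_vars_subset[OF indep_demands_Suc]]) auto
  qed (auto intro: integrable_stationary_cost)
  then show ?thesis by (simp add: variance_stationary_cost)
qed

section \<open>Transfer to the realized cost\<close>

text \<open>Both claims use the split of \<open>cost - stationary_sum\<close> into
  \<open>cost - reference\<close>, bounded in second moment, and the sum of the target gaps, whose
  variance divided by \<open>n\<close> is at most a Cesaro mean of a null sequence.\<close>

lemma square_integrable_cost: "integrable M (\<lambda>\<omega>. (cost n \<omega>)\<^sup>2)"
  and cost_stationary_variance:
    "(\<lambda>n. variance (\<lambda>\<omega>. cost n \<omega> - stationary_sum n \<omega>) / n) \<longlonglongrightarrow> 0"
proof -
  obtain B where int: "\<And>n. integrable M (\<lambda>\<omega>. (cost n \<omega> - reference n \<omega>)\<^sup>2)"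
    and B: "\<And>n. expectation (\<lambda>\<omega>. (cost n \<omega> - reference n \<omega>)\<^sup>2) \<le> B"
    using cost_reference_square by blast
  let ?G = "\<lambda>n \<omega>. \<Sum>i<n. target_gap n i (D (Suc i) \<omega>)"
  have diff: "cost n \<omega> - stationary_sum n \<omega> = (cost n \<omega> - reference n \<omega>) + ?G n \<omega>" for n \<omega>
    by (simp add: reference_eq)
  have intd: "integrable M (\<lambda>\<omega>. (cost n \<omega> - stationary_sum n \<omega>)\<^sup>2)" for n
    unfolding diff by (rule square_integrable_add[OF _ _ int square_integrable_target_gap_sum]) measurable
  show "integrable M (\<lambda>\<omega>. (cost n \<omega>)\<^sup>2)" for n
    using square_integrable_add[OF _ _ intd[of n] square_integrable_stationary_sum[of n]] by simp
  define a where "a k = K\<^sup>2 * (s (Suc k) - stationary_stock)\<^sup>2" for k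
  have "variance (\<lambda>\<omega>. cost n \<omega> - stationary_sum n \<omega>) \<le> 2 * (B + (\<Sum>k<n. a k))" for n
  proof -
    have "variance (\<lambda>\<omega>. cost n \<omega> - stationary_sum n \<omega>)
        \<le> 2 * (expectation (\<lambda>\<omega>. (cost n \<omega> - reference n \<omega>)\<^sup>2) + variance (?G n))"
      unfolding diff
    proof (rule variance_add_le[OF _ int _ square_integrable_target_gap_sum])
      show "integrable M (\<lambda>\<omega>. cost n \<omega> - reference n \<omega>)"
        by (rule square_integrable_imp_integrable[OF _ int]) measurable
      show "integrable M (?G n)"
        by (rule square_integrable_imp_integrable[OF _ square_integrable_target_gap_sum]) measurable
      show "integrable M (\<lambda>\<omega>. ((cost n \<omega> - reference n \<omega>) + ?G n \<omega>)\<^sup>2)"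
        using intd[of n] unfolding diff .
    qed
    then show ?thesis using B[of n] variance_reference_gap_le[of n] by (simp add: a_def)
  qed
  then have "norm (variance (\<lambda>\<omega>. cost n \<omega> - stationary_sum n \<omega>) / n) \<le> 2 * (B + (\<Sum>k<n. a k)) / n" for n
    unfolding real_norm_def abs_of_nonneg[OF divide_nonneg_nonneg[OF variance_positive of_nat_0_le_iff]]
    by (rule divide_right_mono) simp
  then have bound: "norm (variance (\<lambda>\<omega>. cost n \<omega> - stationary_sum n \<omega>) / n) \<le> 2 * (B / n + (\<Sum>k<n. a k) / n)" for n
    by (simp only: add_divide_distrib[symmetric] times_divide_eq_right)
  have "(\<lambda>n. 2 * (B / n + (\<Sum>k<n. a k) / n)) \<longlonglongrightarrow> 2 * (0 + 0)"
  proof (intro tendsto_intros cesaro_null lim_const_over_n)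
    have "a \<longlonglongrightarrow> K\<^sup>2 * (stationary_stock - stationary_stock)\<^sup>2"
      unfolding a_def[abs_def] by (intro tendsto_intros base_stock_tendsto)
    then show "a \<longlonglongrightarrow> 0" by simp
  qed
  then have "(\<lambda>n. 2 * (B / n + (\<Sum>k<n. a k) / n)) \<longlonglongrightarrow> 0" by simp
  then show "(\<lambda>n. variance (\<lambda>\<omega>. cost n \<omega> - stationary_sum n \<omega>) / n) \<longlonglongrightarrow> 0"
    by (rule Lim_null_comparison[OF always_eventually[OF allI[OF bound]]])
qed

text \<open>Compares the centred cost with the centred independent sum. The second moment of their
  difference is the variance of \<open>cost - stationary_sum\<close>, which is \<open>o(n)\<close>,
  while the sum itself has variance \<open>n * stationary_variance\<close>.\<close>

theorem cost_clt:
  "weak_conv_m (\<lambda>n. distr M borel (\<lambda>\<omega>. (cost n \<omega> - expectation (cost n)) / sqrt (variance (cost n))))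
     std_normal_distribution"
proof (rule weak_conv_m_normalized)
  let ?U = "\<lambda>n \<omega>. stationary_sum n \<omega> - n * stationary_mean"
  let ?V = "\<lambda>n \<omega>. cost n \<omega> - expectation (cost n)"
  have intF: "integrable M (stationary_sum n)" and intC: "integrable M (cost n)" for n
    by (rule square_integrable_imp_integrable[OF _ square_integrable_stationary_sum]
        square_integrable_imp_integrable[OF _ square_integrable_cost], measurable)+
  have EU: "expectation (\<lambda>\<omega>. (?U n \<omega>)\<^sup>2) = n * stationary_variance" for n
    using variance_stationary_sum by (simp add: expectation_stationary_sum)
  show "random_variable borel (?U n)" "random_variable borel (?V n)" for n by measurable
  show "integrable M (\<lambda>\<omega>. (?U n \<omega>)\<^sup>2)" "integrable M (\<lambda>\<omega>. (?V n \<omega>)\<^sup>2)" for n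
    using square_integrable_stationary_sum[of n] square_integrable_cost[of n] intF intC
    by (simp_all add: power2_diff)
  \<comment> \<open>At \<open>n = 0\<close> the sum is empty and its variance is 0, hence positivity
    only from \<open>n = 1\<close> on.\<close>
  show "eventually (\<lambda>n. 0 < expectation (\<lambda>\<omega>. (?U n \<omega>)\<^sup>2)) sequentially"
    unfolding EU using eventually_gt_at_top[of 0]
    by eventually_elim (simp add: stationary_variance_pos)
  show "(\<lambda>n. expectation (\<lambda>\<omega>. (?V n \<omega> - ?U n \<omega>)\<^sup>2) / expectation (\<lambda>\<omega>. (?U n \<omega>)\<^sup>2)) \<longlonglongrightarrow> 0"
  proof -
    have "expectation (\<lambda>\<omega>. (?V n \<omega> - ?U n \<omega>)\<^sup>2) = variance (\<lambda>\<omega>. cost n \<omega> - stationary_sum n \<omega>)" for n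
      using intF intC by (simp add: expectation_stationary_sum algebra_simps)
    then show ?thesis
      unfolding EU using tendsto_divide[OF cost_stationary_variance tendsto_const, of stationary_variance]
        stationary_variance_pos by simp
  qed
  show "real_distribution std_normal_distribution" by (rule real_dist_normal_dist)
  show "weak_conv_m (\<lambda>n. distr M borel (\<lambda>\<omega>. ?U n \<omega> / sqrt (expectation (\<lambda>\<omega>. (?U n \<omega>)\<^sup>2)))) std_normal_distribution"
    unfolding EU by (rule stationary_sum_clt)
qed

end

theorem theorem13:
  fixes M :: "'a measure" and D :: "nat \<Rightarrow> 'a \<Rightarrow> real" and \<psi> :: "real \<Rightarrow> real"
    and J c c\<^sub>h c\<^sub>p x :: real
    and C :: "nat \<Rightarrow> 'a \<Rightarrow> real"
  assumes "prob_space M"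
    and "prob_space.indep_vars M (\<lambda>_. borel) D {1..}"
    and "\<And>i. i \<ge> 1 \<Longrightarrow> distributed M lborel (D i) (\<lambda>w. ennreal (\<psi> w))"
    and "\<And>w. \<psi> w \<ge> 0"
    and "0 < J" and "\<And>w. w \<notin> {0..J} \<Longrightarrow> \<psi> w = 0"
    and "typical_class \<psi>"
    and "c \<ge> 0" and "c\<^sub>h > 0" and "c < c\<^sub>p"
    and "x \<in> {- base_stock_limit \<psi> c\<^sub>h c\<^sub>p .. base_stock_limit \<psi> c\<^sub>h c\<^sub>p}"
  defines "C \<equiv> (\<lambda>n \<omega>. realized_cost \<psi> c c\<^sub>h c\<^sub>p n x (\<lambda>i. D i \<omega>))"
  shows "weak_conv_m
           (\<lambda>n. distr M borel
              (\<lambda>\<omega>. (C n \<omega> - prob_space.expectation M (C n)) / sqrt (prob_space.variance M (C n))))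
           std_normal_distribution"
proof -
  interpret prob_space M by fact
  \<comment> \<open>The density is given relative to \<open>lborel\<close>, whose measurable sets
    are those of \<open>borel\<close>, so the two image measures coincide.\<close>
  have law: "distr M borel (D i) = demand_law \<psi>" if "i \<ge> 1" for i
    using distributed_distr_eq_density[OF assms(3)[OF that]]
    by (simp add: demand_law_def cong: distr_cong)
  have meas [measurable]: "(\<lambda>w. ennreal (\<psi> w)) \<in> borel_measurable lborel"
    using assms(3)[of 1] by (simp add: distributed_borel_measurable)
  have rv: "random_variable borel (D 1)"
    using assms(2) unfolding indep_vars_def2 by simp
  have model: "inventory_model \<psi> J c c\<^sub>h c\<^sub>p"
  proof (rule inventory_model.intro)
    show "real_distribution (demand_law \<psi>)"
      unfolding law[of 1, OF order_refl, symmetric] using rv by (rule real_distribution_distr)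
    show "AE w in demand_law \<psi>. w \<in> {0..J}"
      unfolding demand_law_def using assms(6) by (subst AE_density) force+
    show "measure (demand_law \<psi>) {w} = 0" for w
      by (simp add: demand_law_def measure_def emeasure_density nn_integral_indicator_singleton')
  qed (use assms in auto)
  interpret inventory_process \<psi> J c c\<^sub>h c\<^sub>p M D x
    by (intro inventory_process.intro model prob_space_axioms inventory_process_axioms.intro)
      (use assms law in auto)
  show ?thesis
    using cost_clt unfolding cost_def[abs_def] C_def .
qed

end
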